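(* Let $G=(V,E)$ be a simple, connected, undirected graph, let $z$ be the optimal value of the minimum branch vertices problem on $G$ (the minimum number of branch vertices over all spanning trees of $G$), let $L_o$ be the set of obligatory branches of $G$, and let $G'_o$ be the graph obtained from $G$ by performing the obligatory branches based decomposition and the cut edges based decomposition. Let $K$ be the number of connected components of $G'_o$, and for each $k\in\{1,\dots,K\}$ let $z_k$ be the optimal value of the integer program associated with the $k$-th connected component (all these objects are defined in the context). Then an optimal solution to the minimum branch vertices problem on $G$ can be obtained from the solutions of the $K$ connected components of $G'_o$ (that is, of their associated integer programs), and its optimal value is $$z=|L_o|+\sum_{k=1}^K z_k .$$
   Context: Branch vertices and the problem. For a graph $H$, $d_H(v)$ denotes the degree of $v$ in $H$. A vertex $v$ is a branch vertex of a spanning tree $T$ if $d_T(v)>2$. The minimum branch vertices problem on $G$ asks for a spanning tree of $G$ with the minimum number of branch vertices. Obligatory branches. For $v\in V$, $G-v$ is the graph obtained by deleting $v$ and all its incident edges, and $\alpha(v)$ is the number of connected components of $G-v$. A vertex $v$ is an obligatory branch of $G$ if $\alpha(v)\ge 3$; $L_o$ is the set of obligatory branches. Obligatory branches based decomposition. Starting from $G$, each $v\in L_o$ is replaced by $\alpha(v)$ new vertices $v_1,\dots,v_{\alpha(v)}$, one for each connected component of $G-v$. For each $i$, $v_i$ is joined to the neighbours of $v$ lying in the $i$-th connected component of $G-v$, and $v$ with its incident edges is deleted. This is done for all $v\in L_o$. Thus an edge $(u,v)\in E$ becomes the edge between $u$ (or, if $u\in L_o$, the copy of $u$ associated with the component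 of $G-u$ containing $v$) and $v$ (or, if $v\in L_o$, the copy of $v$ associated with the component of $G-v$ containing $u$). The resulting graph is $G_o$. The new vertices $v_i$ are called artificially created. Cut edges based decomposition. A cut edge is an edge whose removal increases the number of connected components, and $B$ is the set of cut edges of $G$. All edges in $B$ (or the edges corresponding to them) are removed. For a vertex $v$, the extra degree $\gamma(v)$ is the number of cut edges in $B$ incident to $v$ in $G$. $G'_o=(V'_o,E'_o)$ is the graph obtained after performing both decompositions. Its connected components are ${G'}_o^k=({V'}_o^k,{E'}_o^k)$, $k=1,\dots,K$. Let ${\overline{V}'}_o^k$ be the set of vertices of ${V'}_o^k$ that are not artificially created. Component integer program. For each $k$, with a variable $x_{uv}$ for each edge $(u,v)\in {E'}_o^k$ and a variable $y_v$ for each vertex $v\in {V'}_o^k$, $z_k$ is the optimal value of $$z_k=\min \sum_{v\in {\overline{V}'}_o^k} y_v$$ subject to $$\sum_{(u,v)\in {E'}_o^k}x_{uv}=|{V'}_o^k|-1,$$ $$\sum_{(u,v)\in {E'}_o^k:\,u,v\in S}x_{uv}\le |S|-1\quad\text{for all nonempty } S\subset {V'}_o^k,$$ $$\sum_{u:(u,v)\in {E'}_o^k}x_{uv}+\gamma(v)\le 2+(d_G(v)-2)\,y_v\quad\text{for all } v\in {\overline{V}'}_o^k,$$ $$x\in\{0,1\}^{|{E'}_o^k|},\qquad y\in\{0,1\}^{|{V'}_o^k|}.$$ *)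

theory Defs
  imports Main
begin

section \<open>Undirected graphs\<close>

text \<open>The tree and spanning tree notions of the AFP entry Graph\_Theory exclude directed cycles only,
  so undirected graphs are set up here with edges as two-element vertex sets.\<close>

record 'v ugraph =
  gverts :: "'v set"
  gedges :: "'v set set"

definition simple_graph :: "'v ugraph \<Rightarrow> bool" where
  "simple_graph G \<longleftrightarrow> finite (gverts G) \<and> (\<forall>e\<in>gedges G. e \<subseteq> gverts G \<and> card e = 2)"

definition deg :: "'v ugraph \<Rightarrow> 'v \<Rightarrow> nat" where
  "deg H v = card {e\<in>gedges H. v \<in> e}"

definition reachable_in :: "'v ugraph \<Rightarrow> 'v \<Rightarrow> 'v \<Rightarrow> bool" where
  "reachable_in H u v \<longleftrightarrow> (u, v) \<in> {(a, b). {a, b} \<in> gedges H}\<^sup>*"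

definition connected_graph :: "'v ugraph \<Rightarrow> bool" where
  "connected_graph H \<longleftrightarrow> gverts H \<noteq> {} \<and> (\<forall>u\<in>gverts H. \<forall>v\<in>gverts H. reachable_in H u v)"

definition component_verts :: "'v ugraph \<Rightarrow> 'v \<Rightarrow> 'v set" where
  "component_verts H v = {w\<in>gverts H. reachable_in H v w}"

definition induced_graph :: "'v ugraph \<Rightarrow> 'v set \<Rightarrow> 'v ugraph" where
  "induced_graph H S = \<lparr>gverts = S, gedges = {e\<in>gedges H. e \<subseteq> S}\<rparr>"

definition graph_components :: "'v ugraph \<Rightarrow> 'v ugraph set" where
  "graph_components H = (\<lambda>v. induced_graph H (component_verts H v)) ` gverts H"

definition has_cycle :: "'v ugraph \<Rightarrow> bool" where
  "has_cycle H \<longleftrightarrow> (\<exists>p. length p \<ge> 3 \<and> distinct p \<and> set p \<subseteq> gverts H \<and>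
     (\<forall>i<length p. {p ! i, p ! (Suc i mod length p)} \<in> gedges H))"

definition is_spanning_tree :: "'v ugraph \<Rightarrow> 'v ugraph \<Rightarrow> bool" where
  "is_spanning_tree T G \<longleftrightarrow>
     gverts T = gverts G \<and> gedges T \<subseteq> gedges G \<and> connected_graph T \<and> \<not> has_cycle T"

section \<open>The minimum branch vertices problem\<close>

definition branch_vertices :: "'v ugraph \<Rightarrow> 'v set" where
  "branch_vertices T = {v\<in>gverts T. deg T v > 2}"

definition min_branch_value :: "'v ugraph \<Rightarrow> nat" where
  "min_branch_value G = Min {card (branch_vertices T) | T. is_spanning_tree T G}"

definition min_branch_optimal :: "'v ugraph \<Rightarrow> 'v ugraph \<Rightarrow> bool" where
  "min_branch_optimal G T \<longleftrightarrow> is_spanning_tree T G \<and>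
     (\<forall>T'. is_spanning_tree T' G \<longrightarrow> card (branch_vertices T) \<le> card (branch_vertices T'))"

section \<open>Obligatory branches and cut edges\<close>

definition delete_vertex :: "'v ugraph \<Rightarrow> 'v \<Rightarrow> 'v ugraph" where
  "delete_vertex G v = \<lparr>gverts = gverts G - {v}, gedges = {e\<in>gedges G. v \<notin> e}\<rparr>"

definition delete_edge :: "'v ugraph \<Rightarrow> 'v set \<Rightarrow> 'v ugraph" where
  "delete_edge G e = \<lparr>gverts = gverts G, gedges = gedges G - {e}\<rparr>"

definition alpha :: "'v ugraph \<Rightarrow> 'v \<Rightarrow> nat" where
  "alpha G v = card (graph_components (delete_vertex G v))"

definition obligatory_branches :: "'v ugraph \<Rightarrow> 'v set" where
  "obligatory_branches G = {v\<in>gverts G. alpha G v \<ge> 3}"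

definition cut_edges :: "'v ugraph \<Rightarrow> 'v set set" where
  "cut_edges G =
     {e\<in>gedges G. card (graph_components (delete_edge G e)) > card (graph_components G)}"

definition extra_degree :: "'v ugraph \<Rightarrow> 'v \<Rightarrow> nat" where
  "extra_degree G v = card {e\<in>cut_edges G. v \<in> e}"

section \<open>The decompositions\<close>

text \<open>\<open>Copy v C\<close> is the artificially created copy of the obligatory branch \<open>v\<close> that
  belongs to the component of \<open>G - v\<close> with vertex set \<open>C\<close>.\<close>

datatype 'v split_vertex = Orig 'v | Copy 'v "'v set"

text \<open>The end that replaces \<open>u\<close> in the edge between \<open>u\<close> and \<open>v\<close>:\<close>

definition split_end :: "'v ugraph \<Rightarrow> 'v \<Rightarrow> 'v \<Rightarrow> 'v split_vertex" where
  "split_end G u v =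
     (if u \<in> obligatory_branches G then Copy u (component_verts (delete_vertex G u) v) else Orig u)"

text \<open>For an edge \<open>e = {a, b}\<close> the pair \<open>(u, v)\<close> below ranges over \<open>(a, b)\<close> and \<open>(b, a)\<close>.\<close>

definition split_edge :: "'v ugraph \<Rightarrow> 'v set \<Rightarrow> 'v split_vertex set" where
  "split_edge G e = {split_end G u v | u v. e = {u, v}}"

definition obligatory_decomposition :: "'v ugraph \<Rightarrow> 'v split_vertex ugraph" where
  "obligatory_decomposition G =
     \<lparr>gverts = Orig ` (gverts G - obligatory_branches G) \<union>
        {Copy v (gverts C) | v C.
           v \<in> obligatory_branches G \<and> C \<in> graph_components (delete_vertex G v)},
      gedges = split_edge G ` gedges G\<rparr>"

definition full_decomposition :: "'v ugraph \<Rightarrow> 'v split_vertex ugraph" where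
  "full_decomposition G =
     \<lparr>gverts = gverts (obligatory_decomposition G),
      gedges = gedges (obligatory_decomposition G) - split_edge G ` cut_edges G\<rparr>"

section \<open>The integer program of a component\<close>

text \<open>\<open>G\<close> is the original graph and \<open>H\<close> a component of its decomposition. The vertices of \<open>H\<close>
  that are not artificially created are those of the form \<open>Orig v\<close>. The programs are over \<open>int\<close>
  because the coefficient \<open>d\<^sub>G(v) - 2\<close> may be negative.\<close>

definition original_verts :: "'v split_vertex ugraph \<Rightarrow> 'v set" where
  "original_verts H = {v. Orig v \<in> gverts H}"

definition ip_feasible :: "'v ugraph \<Rightarrow> 'v split_vertex ugraph \<Rightarrow>
    ('v split_vertex set \<Rightarrow> int) \<Rightarrow> ('v split_vertex \<Rightarrow> int) \<Rightarrow> bool" where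
  "ip_feasible G H x y \<longleftrightarrow>
     (\<Sum>e\<in>gedges H. x e) = int (card (gverts H)) - 1 \<and>
     (\<forall>S. S \<noteq> {} \<and> S \<subset> gverts H \<longrightarrow>
        (\<Sum>e\<in>{e\<in>gedges H. e \<subseteq> S}. x e) \<le> int (card S) - 1) \<and>
     (\<forall>v\<in>original_verts H.
        (\<Sum>e\<in>{e\<in>gedges H. Orig v \<in> e}. x e) + int (extra_degree G v)
          \<le> 2 + (int (deg G v) - 2) * y (Orig v)) \<and>
     (\<forall>e\<in>gedges H. x e \<in> {0, 1}) \<and>
     (\<forall>w\<in>gverts H. y w \<in> {0, 1})"

definition ip_objective :: "'v split_vertex ugraph \<Rightarrow> ('v split_vertex \<Rightarrow> int) \<Rightarrow> int" where
  "ip_objective H y = (\<Sum>v\<in>original_verts H. y (Orig v))"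

definition ip_value :: "'v ugraph \<Rightarrow> 'v split_vertex ugraph \<Rightarrow> int" where
  "ip_value G H = Min {ip_objective H y | x y. ip_feasible G H x y}"

definition ip_optimal :: "'v ugraph \<Rightarrow> 'v split_vertex ugraph \<Rightarrow>
    ('v split_vertex set \<Rightarrow> int) \<Rightarrow> ('v split_vertex \<Rightarrow> int) \<Rightarrow> bool" where
  "ip_optimal G H x y \<longleftrightarrow> ip_feasible G H x y \<and>
     (\<forall>x' y'. ip_feasible G H x' y' \<longrightarrow> ip_objective H y \<le> ip_objective H y')"

text \<open>The subgraph of \<open>G\<close> assembled from solutions \<open>x H\<close> for the components \<open>H\<close>: the cut edges
  together with the edges of \<open>G\<close> whose counterparts are selected by the solutions.\<close>

definition assembled_graph :: "'v ugraph \<Rightarrow>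
    ('v split_vertex ugraph \<Rightarrow> 'v split_vertex set \<Rightarrow> int) \<Rightarrow> 'v ugraph" where
  "assembled_graph G x =
     \<lparr>gverts = gverts G,
      gedges = cut_edges G \<union>
        {e\<in>gedges G. \<exists>H\<in>graph_components (full_decomposition G).
           split_edge G e \<in> gedges H \<and> x H (split_edge G e) = 1}\<rparr>"

end

theory Submission
  imports Defs
begin

text \<open>A cycle through a vertex \<open>u\<close> leaves \<open>u\<close> into and returns from the same component of
  \<open>G - u\<close>, so splitting \<open>u\<close> along these components does not destroy the cycle; conversely merging
  the copies maps walks to walks. Hence the spanning trees of \<open>G\<close> are the cut edges together with
  one spanning tree of each component of the decomposed graph. An obligatory branch has
  degree at least 3 in every spanning tree, and for every other vertex the degree in the tree is
  the left-hand side of the degree constraint of its component program, so that the programs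
  count exactly the remaining branch vertices.\<close>

section \<open>Reachability along a set of edges\<close>

text \<open>Walks cannot be lifted to the decomposed graph between arbitrary vertices: distinct
  copies of one vertex, or the ends of a cut edge, are meant to be separated there. Lifting does
  work between the two ends of a single edge of \<open>G\<close> that is not cut, because that edge
  closes the walk to a cycle. Acyclicity and spanning are therefore phrased through
  \<open>reach\<close> on edge sets, as conditions on the ends of single edges; the form
  \<open>reach T = reach (gedges G)\<close> of spanning also makes sense for disconnected graphs.
  The programs are matched with trees by counting: in a forest, vertices equal edges plus
  components. A program may set \<open>y = 1\<close> at a vertex that is no branch vertex of the
  resulting tree, so a solution gives a tree with an upper bound only; equality arises together with
  the feasible points read off from an arbitrary spanning tree.\<close>

definition reach :: "'a set set \<Rightarrow> ('a \<times> 'a) set" where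
  "reach F = {(a, b). {a, b} \<in> F}\<^sup>*"

lemma reachable_in_iff_reach: "reachable_in H u v \<longleftrightarrow> (u, v) \<in> reach (gedges H)"
  by (simp add: reachable_in_def reach_def)

lemma reach_refl [simp]: "(a, a) \<in> reach F"
  by (simp add: reach_def)

lemma reach_edge: "{a, b} \<in> F \<Longrightarrow> (a, b) \<in> reach F"
  by (auto simp: reach_def)

lemma reach_trans [trans]: "(a, b) \<in> reach F \<Longrightarrow> (b, c) \<in> reach F \<Longrightarrow> (a, c) \<in> reach F"
  by (auto simp: reach_def)

lemma reach_sym: "(a, b) \<in> reach F \<Longrightarrow> (b, a) \<in> reach F"
proof -
  have "sym {(a, b). {a, b} \<in> F}"
    by (auto simp: sym_def insert_commute)
  then show "(a, b) \<in> reach F \<Longrightarrow> (b, a) \<in> reach F"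
    by (metis reach_def sym_rtrancl symD)
qed

lemma reach_subsetI: "(\<And>a b. {a, b} \<in> E \<Longrightarrow> (a, b) \<in> reach F) \<Longrightarrow> reach E \<subseteq> reach F"
  unfolding reach_def by (rule rtrancl_subset_rtrancl) auto

lemma reach_mono: "E \<subseteq> F \<Longrightarrow> reach E \<subseteq> reach F"
  by (rule reach_subsetI) (auto intro: reach_edge)

lemma reach_induct [consumes 1, case_names refl step]:
  assumes "(a, b) \<in> reach F" and "P a"
    and "\<And>c d. (a, c) \<in> reach F \<Longrightarrow> {c, d} \<in> F \<Longrightarrow> P c \<Longrightarrow> P d"
  shows "P b"
  using assms(1) unfolding reach_def
  by (induction rule: rtrancl_induct) (use assms in \<open>auto simp: reach_def\<close>)

text \<open>At most one use of the new edge matters: a second use leads to an end of it that was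
  visited before, and the detour can be cut out.\<close>

lemma reach_insert:
  assumes "(c, d) \<in> reach (insert {a, b} F)"
  shows "(c, d) \<in> reach F \<or> ((c, a) \<in> reach F \<and> (b, d) \<in> reach F) \<or>
    ((c, b) \<in> reach F \<and> (a, d) \<in> reach F)"
  using assms
proof (induction rule: reach_induct)
  case (step u v)
  show ?case
  proof (cases "{u, v} = {a, b}")
    case True
    then show ?thesis using step.IH by (auto simp: doubleton_eq_iff)
  next
    case False
    then have "(u, v) \<in> reach F" using step.hyps by (auto intro: reach_edge)
    then show ?thesis using step.IH by (meson reach_trans)
  qed
qed simp

text \<open>Serves to confine walks to a connected component: edges that touch \<open>S\<close> lie
  inside it, so a walk from \<open>S\<close> never gets out.\<close>

lemma reach_closed:
  assumes "(a, b) \<in> reach F" and "a \<in> S" and "\<And>e. e \<in> F \<Longrightarrow> e \<inter> S \<noteq> {} \<Longrightarrow> e \<subseteq> S"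
  shows "(a, b) \<in> reach {e\<in>F. e \<subseteq> S} \<and> b \<in> S"
  using assms(1)
proof (induction rule: reach_induct)
  case (step c d)
  then have "{c, d} \<subseteq> S" by (intro assms(3)) auto
  then show ?case using step by (auto intro: reach_trans reach_edge)
qed (use assms in simp)

lemma reach_simple_path:
  assumes "(a, b) \<in> reach F"
  obtains p where "p \<noteq> []" "hd p = a" "last p = b" "distinct p"
    "successively (\<lambda>x y. {x, y} \<in> F) p"
proof -
  have "\<exists>p. p \<noteq> [] \<and> hd p = a \<and> last p = b \<and> distinct p \<and> successively (\<lambda>x y. {x, y} \<in> F) p"
    using assms
  proof (induction rule: reach_induct)
    case refl
    show ?case by (rule exI[of _ "[a]"]) simp
  next
    case (step c d)
    then obtain p where p: "p \<noteq> []" "hd p = a" "last p = c" "distinct p"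
      "successively (\<lambda>x y. {x, y} \<in> F) p" by blast
    show ?case
    proof (cases "d \<in> set p")
      case True
      then obtain ps qs where "p = ps @ d # qs" by (meson split_list)
      then have "p = (ps @ [d]) @ qs" by simp
      then show ?thesis using p
        by (intro exI[of _ "ps @ [d]"]) (auto simp: successively_append_iff hd_append)
    next
      case False
      then show ?thesis using p step.hyps
        by (intro exI[of _ "p @ [d]"]) (auto simp: successively_append_iff)
    qed
  qed
  then show thesis using that by blast
qed

lemma successively_imp_reach:
  assumes "successively (\<lambda>x y. {x, y} \<in> F) p" and "p \<noteq> []"
  shows "(hd p, last p) \<in> reach F"
  using assms(2,1)
proof (induction p rule: list_nonempty_induct)
  case (cons x xs)
  then have "{x, hd xs} \<in> F" "(hd xs, last xs) \<in> reach F" by (auto simp: successively_Cons)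
  then show ?case using cons.hyps by (auto intro: reach_edge reach_trans)
qed (use assms in simp)

lemma successively_imp_reach_avoiding:
  assumes "successively (\<lambda>x y. {x, y} \<in> F) p" and "p \<noteq> []" and "v \<notin> set p"
  shows "(hd p, last p) \<in> reach {e\<in>F. v \<notin> e}"
proof (rule successively_imp_reach)
  show "successively (\<lambda>x y. {x, y} \<in> {e\<in>F. v \<notin> e}) p"
    using assms by (auto intro: successively_mono[OF assms(1)])
qed fact

section \<open>Forests\<close>

text \<open>Acyclicity in the form that every edge is a cut edge of \<open>F\<close>. It speaks only
  of walks between the ends of one edge, so it compares directly with \<open>cut_edges_iff\<close>
  and can be carried through the splitting without handling cycles as lists.\<close>

definition forest :: "'a set set \<Rightarrow> bool" where
  "forest F \<longleftrightarrow> (\<forall>a b. {a, b} \<in> F \<longrightarrow> (a, b) \<notin> reach (F - {{a, b}}))"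

lemma forest_subset: "forest F \<Longrightarrow> E \<subseteq> F \<Longrightarrow> forest E"
  unfolding forest_def by (meson Diff_mono order_refl reach_mono subsetD)

text \<open>If an old edge {c, d} became redundant, the walk replacing it would use {a, b}; its two
  remaining pieces together with {c, d} would already join a and b in \<open>F\<close>.\<close>

lemma forest_insert:
  assumes "forest F" and "(a, b) \<notin> reach F"
  shows "forest (insert {a, b} F)"
  unfolding forest_def
proof (intro allI impI notI)
  fix c d
  assume cd: "{c, d} \<in> insert {a, b} F" and r: "(c, d) \<in> reach (insert {a, b} F - {{c, d}})"
  show False
  proof (cases "{c, d} = {a, b}")
    case True
    then have "(c, d) \<in> reach F"
      using r reach_mono[of "insert {a, b} F - {{c, d}}" F] by auto
    then show False using True assms(2) by (auto simp: doubleton_eq_iff dest: reach_sym)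
  next
    case False
    let ?F = "F - {{c, d}}"
    have cdF: "{c, d} \<in> F" using cd False by simp
    have "(c, d) \<in> reach (insert {a, b} ?F)" using r False by (simp add: insert_Diff_if)
    moreover have "(c, d) \<notin> reach ?F" using assms(1) cdF by (simp add: forest_def)
    moreover have "reach ?F \<subseteq> reach F" by (rule reach_mono) auto
    moreover have "(c, d) \<in> reach F" "(d, c) \<in> reach F"
      using cdF by (auto intro: reach_edge reach_sym)
    ultimately show False using reach_insert[of c d a b ?F] assms(2)
      by (meson reach_sym reach_trans subsetD)
  qed
qed

text \<open>A maximal forest in \<open>E\<close> spans, since an edge of \<open>E\<close> with
  separated ends could still be added by \<open>forest_insert\<close>.\<close>

lemma exists_spanning_forest:
  assumes "finite E"
  obtains F where "F \<subseteq> E" "forest F" "reach F = reach E"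
proof -
  have "finite {F. F \<subseteq> E \<and> forest F}" "{} \<in> {F. F \<subseteq> E \<and> forest F}"
    using assms by (simp_all add: forest_def)
  then obtain F where F: "F \<subseteq> E" "forest F"
    and max: "\<And>F'. F' \<subseteq> E \<Longrightarrow> forest F' \<Longrightarrow> F \<subseteq> F' \<Longrightarrow> F = F'"
    using finite_has_maximal[of "{F. F \<subseteq> E \<and> forest F}"]
    by (metis (mono_tags, lifting) empty_iff mem_Collect_eq)
  have "(a, b) \<in> reach F" if "{a, b} \<in> E" for a b
  proof (rule ccontr)
    assume "(a, b) \<notin> reach F"
    then have "F = insert {a, b} F" using F that by (intro max) (auto intro: forest_insert)
    then show False using \<open>(a, b) \<notin> reach F\<close> by (metis insertI1 reach_edge)
  qed
  then have "reach E \<subseteq> reach F" by (rule reach_subsetI)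
  then show thesis using that F reach_mono[OF F(1)] by auto
qed

section \<open>Counting connected components\<close>

definition comp_of :: "'a set \<Rightarrow> 'a set set \<Rightarrow> 'a \<Rightarrow> 'a set" where
  "comp_of V F v = {w\<in>V. (v, w) \<in> reach F}"

lemma comp_of_eq_iff:
  assumes "v \<in> V" "w \<in> V"
  shows "comp_of V F v = comp_of V F w \<longleftrightarrow> (v, w) \<in> reach F"
proof
  assume "comp_of V F v = comp_of V F w"
  then have "w \<in> comp_of V F v" using assms by (simp add: comp_of_def)
  then show "(v, w) \<in> reach F" by (simp add: comp_of_def)
next
  assume "(v, w) \<in> reach F"
  then show "comp_of V F v = comp_of V F w"
    unfolding comp_of_def by (metis reach_sym reach_trans)
qed

text \<open>The classes of a and b merge and all others stay as they are. The drop by one is written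
  as an addition on the left to avoid truncated subtraction.\<close>

lemma card_comps_insert:
  assumes "finite V" "a \<in> V" "b \<in> V"
  shows "card (comp_of V (insert {a, b} F) ` V) + (if (a, b) \<in> reach F then 0 else 1) =
    card (comp_of V F ` V)"
proof (cases "(a, b) \<in> reach F")
  case True
  have "reach (insert {a, b} F) = reach F"
    using True by (intro equalityI reach_subsetI reach_mono)
      (auto simp: doubleton_eq_iff intro: reach_edge reach_sym)
  then show ?thesis using True by (simp add: comp_of_def)
next
  case False
  let ?F = "insert {a, b} F" and ?c = "comp_of V F"
  have mono: "reach F \<subseteq> reach ?F" by (rule reach_mono) auto
  have ab: "(a, b) \<in> reach ?F" by (simp add: reach_edge)
  have merged: "comp_of V ?F v = ?c a \<union> ?c b" if "v \<in> V" "v \<in> ?c a \<union> ?c b" for v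
  proof -
    have "(a, v) \<in> reach ?F" using that ab mono unfolding comp_of_def
      by (auto dest: reach_trans)
    then have "(v, w) \<in> reach ?F \<longleftrightarrow> (a, w) \<in> reach ?F" for w
      by (meson reach_sym reach_trans)
    moreover have "(a, w) \<in> reach ?F \<longleftrightarrow> (a, w) \<in> reach F \<or> (b, w) \<in> reach F" for w
      using reach_insert[of a w a b F] mono ab by (meson reach_trans subsetD)
    ultimately show ?thesis unfolding comp_of_def by auto
  qed
  have kept: "comp_of V ?F v = ?c v" if "v \<in> V" "v \<notin> ?c a \<union> ?c b" for v
  proof -
    have "(v, a) \<notin> reach F" "(v, b) \<notin> reach F"
      using that unfolding comp_of_def by (auto dest: reach_sym)
    then have "(v, w) \<in> reach ?F \<longleftrightarrow> (v, w) \<in> reach F" for w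
      using reach_insert[of v w a b F] mono by auto
    then show ?thesis unfolding comp_of_def by auto
  qed
  have ne: "?c a \<noteq> ?c b" using False assms by (simp add: comp_of_eq_iff)
  have mem: "v \<in> ?c a \<union> ?c b \<longleftrightarrow> ?c v = ?c a \<or> ?c v = ?c b" if "v \<in> V" for v
    unfolding comp_of_eq_iff[OF that assms(2)] comp_of_eq_iff[OF that assms(3)]
    using that by (auto simp: comp_of_def intro: reach_sym)
  have "comp_of V ?F ` V = insert (?c a \<union> ?c b) (?c ` V - {?c a, ?c b})"
  proof (intro equalityI subsetI)
    fix C assume "C \<in> comp_of V ?F ` V"
    then obtain v where v: "v \<in> V" "C = comp_of V ?F v" by blast
    then show "C \<in> insert (?c a \<union> ?c b) (?c ` V - {?c a, ?c b})"
      using merged[of v] kept[of v] mem[of v] by (cases "v \<in> ?c a \<union> ?c b") auto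
  next
    fix C assume C: "C \<in> insert (?c a \<union> ?c b) (?c ` V - {?c a, ?c b})"
    show "C \<in> comp_of V ?F ` V"
    proof (cases "C = ?c a \<union> ?c b")
      case True
      have "a \<in> ?c a" using assms by (simp add: comp_of_def)
      then show ?thesis using True merged[of a] assms by (metis UnI1 imageI)
    next
      case False
      then obtain v where v: "v \<in> V" "C = ?c v" "?c v \<noteq> ?c a" "?c v \<noteq> ?c b" using C by auto
      then show ?thesis using kept[of v] mem[of v] by (metis imageI)
    qed
  qed
  moreover have "?c a \<union> ?c b \<notin> ?c ` V - {?c a, ?c b}"
  proof
    assume "?c a \<union> ?c b \<in> ?c ` V - {?c a, ?c b}"
    then obtain v where v: "v \<in> V" "?c v = ?c a \<union> ?c b" "?c v \<noteq> ?c a" "?c v \<noteq> ?c b" by auto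
    then have "v \<in> ?c a \<union> ?c b" by (metis (mono_tags, lifting) comp_of_def mem_Collect_eq reach_refl)
    then show False using v mem by blast
  qed
  moreover have "card (?c ` V - {?c a, ?c b}) + 2 = card (?c ` V)"
  proof -
    have "card {?c a, ?c b} = 2" using ne by simp
    moreover have "{?c a, ?c b} \<subseteq> ?c ` V" using assms by auto
    ultimately show ?thesis using assms(1)
      by (metis card_Diff_subset card_mono finite_imageI finite_subset le_add_diff_inverse2)
  qed
  ultimately show ?thesis using False assms(1) by simp
qed

text \<open>Without edges every vertex is a component of its own; each inserted edge lowers the
  number of components by at most one, in a forest by exactly one. The inequality bounds the number
  of edges of a connected graph from below.\<close>

lemma card_forest:
  assumes "finite V" "finite F" "\<And>e. e \<in> F \<Longrightarrow> e \<subseteq> V \<and> card e = 2"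
  shows "card V \<le> card F + card (comp_of V F ` V)"
    and "forest F \<Longrightarrow> card V = card F + card (comp_of V F ` V)"
proof -
  have "card V \<le> card F + card (comp_of V F ` V) \<and>
    (forest F \<longrightarrow> card V = card F + card (comp_of V F ` V))"
    using assms(2,3)
  proof (induction F rule: finite_induct)
    case empty
    have "(v, w) \<in> reach {} \<longleftrightarrow> v = w" for v w :: 'a by (simp add: reach_def)
    then have "inj_on (comp_of V {}) V" by (auto simp: inj_on_def comp_of_eq_iff)
    then show ?case by (simp add: card_image)
  next
    case (insert e F)
    then obtain a b where e: "e = {a, b}" "a \<in> V" "b \<in> V"
      by (metis card_2_iff insert_subset insertI1)
    have IH: "card V \<le> card F + card (comp_of V F ` V)"
      "forest F \<Longrightarrow> card V = card F + card (comp_of V F ` V)"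
      using insert by auto
    note c = card_comps_insert[OF assms(1) e(2,3), of F]
    have "forest F \<and> (a, b) \<notin> reach F" if "forest (insert e F)"
      using that insert.hyps e(1) forest_subset[of "insert e F" F]
      by (auto simp: forest_def)
    moreover have "card (insert e F) = Suc (card F)" using insert.hyps by simp
    ultimately show ?case using IH c unfolding e(1) by (cases "(a, b) \<in> reach F") auto
  qed
  then show "card V \<le> card F + card (comp_of V F ` V)"
    and "forest F \<Longrightarrow> card V = card F + card (comp_of V F ` V)" by auto
qed

section \<open>Cycles and forests in simple graphs\<close>

lemma simple_graphD:
  assumes "simple_graph H"
  shows "finite (gverts H)" "finite (gedges H)"
    "\<And>e. e \<in> gedges H \<Longrightarrow> e \<subseteq> gverts H" "\<And>e. e \<in> gedges H \<Longrightarrow> card e = 2"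
    "\<And>a b. {a, b} \<in> gedges H \<Longrightarrow> a \<noteq> b \<and> a \<in> gverts H \<and> b \<in> gverts H"
proof -
  show *: "finite (gverts H)" "\<And>e. e \<in> gedges H \<Longrightarrow> e \<subseteq> gverts H"
    "\<And>e. e \<in> gedges H \<Longrightarrow> card e = 2"
    using assms by (auto simp: simple_graph_def)
  then have "gedges H \<subseteq> Pow (gverts H)" by blast
  then show "finite (gedges H)" using *(1) by (meson finite_Pow_iff finite_subset)
  show "a \<noteq> b \<and> a \<in> gverts H \<and> b \<in> gverts H" if "{a, b} \<in> gedges H" for a b
    using *(2)[OF that] *(3)[OF that] by auto
qed

lemma simple_graph_edgeE:
  assumes "simple_graph H" "e \<in> gedges H"
  obtains a b where "e = {a, b}" "a \<noteq> b" "a \<in> gverts H" "b \<in> gverts H"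
  using simple_graphD(4)[OF assms] simple_graphD(3)[OF assms] by (auto simp: card_2_iff)

lemma has_cycle_iff_not_forest:
  assumes "simple_graph H"
  shows "has_cycle H \<longleftrightarrow> \<not> forest (gedges H)"
proof
  assume "has_cycle H"
  then obtain p where p: "length p \<ge> 3" "distinct p"
    "\<And>i. i < length p \<Longrightarrow> {p ! i, p ! (Suc i mod length p)} \<in> gedges H"
    by (auto simp: has_cycle_def)
  define n where "n = length p - 1"
  have n: "length p = Suc n" "n \<ge> 2" using p(1) by (auto simp: n_def)
  let ?e = "{p ! 0, p ! n}"
  have "?e \<in> gedges H" using p(3)[of n] n by (simp add: insert_commute)
  moreover have "successively (\<lambda>x y. {x, y} \<in> gedges H - {?e}) p"
    unfolding successively_conv_nth
  proof (intro allI impI)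
    fix i assume i: "Suc i < length p"
    then have "{p ! i, p ! Suc i} \<in> gedges H" using p(3)[of i] by simp
    \<comment> \<open>Here \<open>n \<ge> 2\<close> matters: with only two vertices the closing edge
      would coincide with the edge between list neighbours.\<close>
    moreover have "{p ! i, p ! Suc i} \<noteq> ?e"
      using i n p(2) by (auto simp: doubleton_eq_iff nth_eq_iff_index_eq)
    ultimately show "{p ! i, p ! Suc i} \<in> gedges H - {?e}" by simp
  qed
  moreover have "p \<noteq> []" using n by auto
  ultimately have "?e \<in> gedges H \<and> (p ! 0, p ! n) \<in> reach (gedges H - {?e})"
    using successively_imp_reach[of "gedges H - {?e}" p] n
    by (simp add: hd_conv_nth last_conv_nth)
  then show "\<not> forest (gedges H)" unfolding forest_def by blast
next
  assume "\<not> forest (gedges H)"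
  then obtain a b where ab: "{a, b} \<in> gedges H" "(a, b) \<in> reach (gedges H - {{a, b}})"
    by (auto simp: forest_def)
  then obtain p where p: "p \<noteq> []" "hd p = a" "last p = b" "distinct p"
    and s: "successively (\<lambda>x y. {x, y} \<in> gedges H - {{a, b}}) p"
    by (elim reach_simple_path)
  have "a \<noteq> b" using simple_graphD(5)[OF assms ab(1)] by simp
  obtain q where q: "p = a # q" using p(1,2) by (cases p) auto
  then obtain u r where r: "q = u # r" using p(3) \<open>a \<noteq> b\<close> by (cases q) auto
  \<comment> \<open>Otherwise the path would consist of the edge {a, b}, which has been
    removed.\<close>
  then have "r \<noteq> []" using p(3) s q by auto
  then have "length p \<ge> 3" using q r by (cases r) auto
  moreover have edges: "{p ! i, p ! (Suc i mod length p)} \<in> gedges H" if "i < length p" for i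
  proof (cases "Suc i < length p")
    case True
    then show ?thesis using s by (simp add: successively_conv_nth)
  next
    case False
    then have "Suc i = length p" using that by simp
    then have "p ! i = b" "p ! (Suc i mod length p) = a"
      using p by (auto simp: last_conv_nth hd_conv_nth simp flip: \<open>Suc i = length p\<close>)
    then show ?thesis using ab(1) by (simp add: insert_commute)
  qed
  moreover have "set p \<subseteq> gverts H"
    using simple_graphD(3)[OF assms edges] by (auto simp: in_set_conv_nth)
  ultimately show "has_cycle H" using p(4) unfolding has_cycle_def by blast
qed

section \<open>Spanning trees as edge sets and the subtour constraints\<close>

definition tree_edges :: "'a ugraph \<Rightarrow> 'a set set \<Rightarrow> bool" where
  "tree_edges H F \<longleftrightarrow> F \<subseteq> gedges H \<and> forest F \<and> (\<forall>u\<in>gverts H. \<forall>v\<in>gverts H. (u, v) \<in> reach F)"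

lemma is_spanning_tree_iff_tree_edges:
  assumes "simple_graph G" "gverts G \<noteq> {}"
  shows "is_spanning_tree T G \<longleftrightarrow> gverts T = gverts G \<and> tree_edges G (gedges T)"
proof -
  have "simple_graph T" if "gverts T = gverts G" "gedges T \<subseteq> gedges G"
    using that assms by (auto simp: simple_graph_def)
  then show ?thesis
    using assms has_cycle_iff_not_forest[of T]
    by (auto simp: is_spanning_tree_def tree_edges_def connected_graph_def reachable_in_iff_reach)
qed

lemma comp_of_connected:
  assumes "V \<noteq> {}" "\<And>u v. u \<in> V \<Longrightarrow> v \<in> V \<Longrightarrow> (u, v) \<in> reach F"
  shows "comp_of V F ` V = {V}"
  using assms by (auto simp: comp_of_def)

lemma sum_binary:
  fixes x :: "'a \<Rightarrow> int"
  assumes "finite A" "\<And>e. e \<in> A \<Longrightarrow> x e \<in> {0, 1}"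
  shows "sum x A = int (card {e\<in>A. x e = 1})"
proof -
  have "sum x A = (\<Sum>e\<in>A. if x e = 1 then 1 else 0)"
    using assms(2) by (intro sum.cong) auto
  also have "\<dots> = int (card {e\<in>A. x e = 1})" using assms(1) by (simp add: sum.If_cases Int_def)
  finally show ?thesis .
qed

text \<open>A tree meets the subset bounds because its restriction to \<open>S\<close> is a forest
  with at least one component. Conversely the bounds forbid cycles, and a forest with one edge less
  than vertices has a single component.\<close>

lemma subtour_constraints_iff_tree_edges:
  fixes H :: "'a ugraph" and x :: "'a set \<Rightarrow> int"
  assumes H: "simple_graph H" "gverts H \<noteq> {}" and x: "\<And>e. e \<in> gedges H \<Longrightarrow> x e \<in> {0, 1}"
  shows "(\<Sum>e\<in>gedges H. x e) = int (card (gverts H)) - 1 \<and>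
     (\<forall>S. S \<noteq> {} \<and> S \<subset> gverts H \<longrightarrow>
        (\<Sum>e\<in>{e\<in>gedges H. e \<subseteq> S}. x e) \<le> int (card S) - 1) \<longleftrightarrow>
     tree_edges H {e\<in>gedges H. x e = 1}"
    (is "?L \<longleftrightarrow> tree_edges H ?F")
proof -
  let ?V = "gverts H"
  note H' = simple_graphD[OF H(1)]
  have finF: "finite ?F" and F: "\<And>e. e \<in> ?F \<Longrightarrow> e \<subseteq> ?V \<and> card e = 2"
    using H' by auto
  have sum_E: "(\<Sum>e\<in>gedges H. x e) = int (card ?F)"
    using H'(2) x by (rule sum_binary)
  have sum_S: "(\<Sum>e\<in>{e\<in>gedges H. e \<subseteq> S}. x e) = int (card {e\<in>?F. e \<subseteq> S})" for S
  proof -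
    have "(\<Sum>e\<in>{e\<in>gedges H. e \<subseteq> S}. x e) = int (card {e\<in>{e\<in>gedges H. e \<subseteq> S}. x e = 1})"
      using H'(2) x by (intro sum_binary) auto
    then show ?thesis by (simp add: conj_commute conj_left_commute)
  qed
  show ?thesis
  proof
    assume T: "tree_edges H ?F"
    have "comp_of ?V ?F ` ?V = {?V}" using T H(2) unfolding tree_edges_def
      by (intro comp_of_connected) auto
    then have "card ?V = card ?F + 1"
      using card_forest(2)[OF H'(1) finF F] T by (simp add: tree_edges_def)
    moreover have "int (card {e\<in>?F. e \<subseteq> S}) \<le> int (card S) - 1" if "S \<noteq> {}" "S \<subset> ?V" for S
    proof -
      let ?FS = "{e\<in>?F. e \<subseteq> S}"
      have S: "finite S" using that H'(1) by (meson finite_subset psubsetE)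
      have "forest ?FS" using T forest_subset[of ?F ?FS] by (auto simp: tree_edges_def)
      moreover have "finite ?FS" using finF by (rule rev_finite_subset) auto
      ultimately have "card S = card ?FS + card (comp_of S ?FS ` S)"
        using F by (intro card_forest(2)[OF S]) auto
      moreover have "card (comp_of S ?FS ` S) > 0" using S that by (simp add: card_gt_0_iff)
      ultimately show ?thesis by linarith
    qed
    ultimately show ?L unfolding sum_E sum_S by auto
  next
    assume L: ?L
    have cardF: "card ?V = card ?F + 1" using L unfolding sum_E by linarith
    \<comment> \<open>The program bounds proper subsets only; for the whole vertex set the bound
      comes from the prescribed number of edges.\<close>
    have sub: "card {e\<in>?F. e \<subseteq> S} < card S" if "S \<noteq> {}" "S \<subseteq> ?V" for S
    proof (cases "S = ?V")
      case True
      then have "{e\<in>?F. e \<subseteq> S} = ?F" using F by blast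
      then show ?thesis using cardF True by simp
    next
      case False
      then have "int (card {e\<in>?F. e \<subseteq> S}) \<le> int (card S) - 1"
        using L that unfolding sum_S by blast
      then show ?thesis by linarith
    qed
    have "forest ?F"
      unfolding forest_def
    proof (intro allI impI notI)
      fix a b assume ab: "{a, b} \<in> ?F" and r: "(a, b) \<in> reach (?F - {{a, b}})"
      \<comment> \<open>If {a, b} is redundant, the component \<open>?C\<close> of a stays connected
        through \<open>?G\<close>, so \<open>?G\<close> has at least \<open>card ?C - 1\<close>
        edges. Since {a, b} lies inside \<open>?C\<close> as well, there are at least
        \<open>card ?C\<close> edges in it, against \<open>sub\<close>.\<close>
      let ?F' = "?F - {{a, b}}" and ?C = "comp_of ?V ?F a"
      let ?G = "{e\<in>?F'. e \<subseteq> ?C}"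
      have aV: "a \<in> ?V" using F[OF ab] by simp
      then have aC: "a \<in> ?C" by (simp add: comp_of_def)
      have CV: "?C \<subseteq> ?V" by (auto simp: comp_of_def)
      have closed: "e \<subseteq> ?C" if e_mem: "e \<in> ?F" "e \<inter> ?C \<noteq> {}" for e
      proof -
        obtain c d where e: "e = {c, d}" "c \<in> ?V" "d \<in> ?V"
          using e_mem(1) H(1) simple_graph_edgeE[of H e] by blast
        have "(c, d) \<in> reach ?F" "(d, c) \<in> reach ?F"
          using that e by (auto intro: reach_edge reach_sym)
        then show ?thesis using that(2) e unfolding comp_of_def by (auto intro: reach_trans)
      qed
      have "reach ?F \<subseteq> reach ?F'"
      proof (rule reach_subsetI)
        fix c d assume cd: "{c, d} \<in> ?F"
        show "(c, d) \<in> reach ?F'"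
        proof (cases "{c, d} = {a, b}")
          case True
          then show ?thesis using r by (auto simp: doubleton_eq_iff intro: reach_sym)
        next
          case False
          then show ?thesis using cd by (intro reach_edge) simp
        qed
      qed
      have conn: "(a, w) \<in> reach ?G" if "w \<in> ?C" for w
      proof -
        have "(a, w) \<in> reach ?F'" using that \<open>reach ?F \<subseteq> reach ?F'\<close> by (auto simp: comp_of_def)
        then show ?thesis using reach_closed[of a w ?F' ?C] aC closed by blast
      qed
      have finG: "finite ?G" using finF by (rule rev_finite_subset) auto
      have "comp_of ?C ?G ` ?C = {?C}" using aC conn
        by (intro comp_of_connected) (auto intro: reach_sym reach_trans)
      moreover have "card ?C \<le> card ?G + card (comp_of ?C ?G ` ?C)"
      proof (rule card_forest(1))
        show "finite ?C" using CV H'(1) by (rule finite_subset)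
        show "finite ?G" using finG .
        show "e \<subseteq> ?C \<and> card e = 2" if "e \<in> ?G" for e using that F by auto
      qed
      moreover have "{e\<in>?F. e \<subseteq> ?C} = insert {a, b} ?G" using closed[OF ab] ab aC by auto
      then have "card {e\<in>?F. e \<subseteq> ?C} = Suc (card ?G)" using finG by simp
      ultimately have "card ?C \<le> card {e\<in>?F. e \<subseteq> ?C}" by simp
      then show False using sub[of ?C] aC CV by auto
    qed
    then have "card (comp_of ?V ?F ` ?V) = 1"
      using card_forest(2)[OF H'(1) finF F] cardF by simp
    then obtain C where C: "comp_of ?V ?F ` ?V = {C}" by (rule card_1_singletonE)
    have "(u, v) \<in> reach ?F" if "u \<in> ?V" "v \<in> ?V" for u v
    proof -
      have "comp_of ?V ?F u = C" "comp_of ?V ?F v = C" using C that by blast+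
      then show ?thesis using comp_of_eq_iff[OF that, of ?F] by simp
    qed
    then show "tree_edges H ?F"
      using \<open>forest ?F\<close> by (auto simp: tree_edges_def)
  qed
qed

section \<open>Connected components\<close>

lemma component_verts_eq_comp_of: "component_verts H = comp_of (gverts H) (gedges H)"
  by (auto simp: component_verts_def comp_of_def reachable_in_iff_reach)

text \<open>Links the two ways of counting: the definitions count components as graphs,
  \<open>card_comps_insert\<close> counts vertex classes.\<close>

lemma card_graph_components:
  "card (graph_components H) = card (comp_of (gverts H) (gedges H) ` gverts H)"
proof -
  have "graph_components H = induced_graph H ` (comp_of (gverts H) (gedges H) ` gverts H)"
    by (auto simp: graph_components_def component_verts_eq_comp_of)
  moreover have "inj (induced_graph H)" by (auto simp: inj_def induced_graph_def)
  ultimately show ?thesis by (metis card_image inj_on_subset subset_UNIV)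
qed

lemma component_edge_closed:
  assumes "H \<in> graph_components D" "e \<in> gedges D" "e \<inter> gverts H \<noteq> {}" "simple_graph D"
  shows "e \<in> gedges H" "e \<subseteq> gverts H"
proof -
  obtain v where H: "H = induced_graph D (component_verts D v)"
    using assms(1) by (auto simp: graph_components_def)
  obtain a b where e: "e = {a, b}" "a \<in> gverts D" "b \<in> gverts D"
    using assms(2,4) by (elim simple_graph_edgeE)
  have "(a, b) \<in> reach (gedges D)" "(b, a) \<in> reach (gedges D)"
    using assms(2) e by (auto intro: reach_edge reach_sym)
  then show "e \<subseteq> gverts H" using assms(3) e
    by (auto simp: H induced_graph_def component_verts_eq_comp_of comp_of_def intro: reach_trans)
  then show "e \<in> gedges H" using assms(2) by (simp add: H induced_graph_def)
qed

lemma component_props: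
  assumes "H \<in> graph_components D"
  shows "gedges H = {e\<in>gedges D. e \<subseteq> gverts H}" "gverts H \<subseteq> gverts D" "gverts H \<noteq> {}"
    "\<And>u w. u \<in> gverts H \<Longrightarrow> w \<in> gverts H \<Longrightarrow> (u, w) \<in> reach (gedges D)"
proof -
  obtain v where v: "v \<in> gverts D" and H: "H = induced_graph D (component_verts D v)"
    using assms by (auto simp: graph_components_def)
  show "gedges H = {e\<in>gedges D. e \<subseteq> gverts H}" by (auto simp: H induced_graph_def)
  show "gverts H \<subseteq> gverts D" "gverts H \<noteq> {}" using v
    by (auto simp: H induced_graph_def component_verts_eq_comp_of comp_of_def)
  show "(u, w) \<in> reach (gedges D)" if "u \<in> gverts H" "w \<in> gverts H" for u w
    using that by (auto simp: H induced_graph_def component_verts_eq_comp_of comp_of_def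
        intro: reach_trans reach_sym)
qed

lemma component_simple_graph:
  assumes "H \<in> graph_components D" "simple_graph D"
  shows "simple_graph H"
  using component_props(1,2)[OF assms(1)] assms(2)
  by (auto simp: simple_graph_def intro: finite_subset)

lemma component_unique:
  assumes "H \<in> graph_components D" "H' \<in> graph_components D" "v \<in> gverts H" "v \<in> gverts H'"
  shows "H = H'"
proof -
  have "H = induced_graph D (component_verts D v)"
    if H: "H \<in> graph_components D" "v \<in> gverts H" for H
  proof -
    obtain u where u: "u \<in> gverts D" "H = induced_graph D (component_verts D u)"
      using H(1) unfolding graph_components_def by blast
    then have "v \<in> gverts D" "(u, v) \<in> reach (gedges D)"
      using H(2) by (auto simp: induced_graph_def component_verts_eq_comp_of comp_of_def)
    then have "component_verts D u = component_verts D v"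
      using u(1) by (simp add: component_verts_eq_comp_of comp_of_eq_iff)
    then show ?thesis using u(2) by simp
  qed
  then show ?thesis using assms by metis
qed

lemma component_exists:
  assumes "v \<in> gverts D"
  obtains H where "H \<in> graph_components D" "v \<in> gverts H"
proof
  show "induced_graph D (component_verts D v) \<in> graph_components D"
    using assms by (simp add: graph_components_def)
  show "v \<in> gverts (induced_graph D (component_verts D v))"
    using assms by (simp add: induced_graph_def component_verts_eq_comp_of comp_of_def)
qed

lemma component_edge_exists:
  assumes "e \<in> gedges D" "simple_graph D"
  obtains H where "H \<in> graph_components D" "e \<in> gedges H"
proof -
  obtain a b where e: "e = {a, b}" "a \<in> gverts D" using assms by (elim simple_graph_edgeE)
  obtain H where "H \<in> graph_components D" "a \<in> gverts H" using component_exists[OF e(2)] .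
  then show thesis using that component_edge_closed(1)[of H D e] assms e(1) by auto
qed

lemma component_edge_unique:
  assumes "H \<in> graph_components D" "H' \<in> graph_components D" "e \<in> gedges H" "e \<in> gedges H'"
    "simple_graph D"
  shows "H = H'"
proof -
  obtain a b where "e = {a, b}" "a \<in> gverts H"
    using simple_graph_edgeE[OF component_simple_graph[OF assms(1,5)] assms(3)] by metis
  then show ?thesis using component_unique[OF assms(1,2), of a] component_props(1)[OF assms(2)]
    assms(4) by auto
qed

text \<open>Spanning is expressed by equal reachability because \<open>D\<close> is disconnected in
  general. A walk never leaves its component, so both conditions can be checked in each component
  separately.\<close>

lemma spanning_forest_iff_components:
  assumes D: "simple_graph D" and F: "F \<subseteq> gedges D"
  shows "forest F \<and> reach F = reach (gedges D) \<longleftrightarrow>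
    (\<forall>H\<in>graph_components D. tree_edges H (F \<inter> gedges H))"
proof
  assume L: "forest F \<and> reach F = reach (gedges D)"
  show "\<forall>H\<in>graph_components D. tree_edges H (F \<inter> gedges H)"
  proof
    fix H assume H: "H \<in> graph_components D"
    have FH: "{e\<in>F. e \<subseteq> gverts H} = F \<inter> gedges H" using F component_props(1)[OF H] by blast
    have "(u, v) \<in> reach (F \<inter> gedges H)" if "u \<in> gverts H" "v \<in> gverts H" for u v
    proof -
      have "(u, v) \<in> reach F" using L component_props(4)[OF H that] by simp
      then show ?thesis
        using reach_closed[of u v F "gverts H"] that component_edge_closed(2)[OF H _ _ D] F
        unfolding FH by blast
    qed
    then show "tree_edges H (F \<inter> gedges H)"
      using L forest_subset[of F "F \<inter> gedges H"] by (auto simp: tree_edges_def)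
  qed
next
  assume R: "\<forall>H\<in>graph_components D. tree_edges H (F \<inter> gedges H)"
  have "forest F"
    unfolding forest_def
  proof (intro allI impI notI)
    fix a b assume ab: "{a, b} \<in> F" and r: "(a, b) \<in> reach (F - {{a, b}})"
    obtain H where H: "H \<in> graph_components D" "{a, b} \<in> gedges H"
      using ab F D by (meson component_edge_exists subsetD)
    have "a \<in> gverts H" using H component_props(1)[OF H(1)] by auto
    then have "(a, b) \<in> reach {e\<in>F - {{a, b}}. e \<subseteq> gverts H}"
      using reach_closed[OF r, of "gverts H"] component_edge_closed(2)[OF H(1) _ _ D] F by blast
    moreover have "{e\<in>F - {{a, b}}. e \<subseteq> gverts H} = F \<inter> gedges H - {{a, b}}"
      using F component_props(1)[OF H(1)] by blast
    ultimately show False using R H ab by (auto simp: tree_edges_def forest_def)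
  qed
  moreover have "reach (gedges D) \<subseteq> reach F"
  proof (rule reach_subsetI)
    fix a b assume ab: "{a, b} \<in> gedges D"
    obtain H where H: "H \<in> graph_components D" "{a, b} \<in> gedges H"
      using ab D by (meson component_edge_exists)
    have "a \<in> gverts H" "b \<in> gverts H" using H component_props(1)[OF H(1)] by auto
    then have "(a, b) \<in> reach (F \<inter> gedges H)" using R H(1) by (auto simp: tree_edges_def)
    then show "(a, b) \<in> reach F" using reach_mono[of "F \<inter> gedges H" F] by auto
  qed
  ultimately show "forest F \<and> reach F = reach (gedges D)" using reach_mono[OF F] by auto
qed

section \<open>Cut edges and obligatory branches\<close>

text \<open>By \<open>card_comps_insert\<close>, putting the edge back lowers the number of
  components exactly if its ends were separated.\<close>

lemma cut_edges_iff:
  assumes "simple_graph G"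
  shows "{a, b} \<in> cut_edges G \<longleftrightarrow>
    {a, b} \<in> gedges G \<and> (a, b) \<notin> reach (gedges G - {{a, b}})"
proof (cases "{a, b} \<in> gedges G")
  case True
  have "a \<in> gverts G" "b \<in> gverts G" using simple_graphD(5)[OF assms True] by auto
  note c = card_comps_insert[OF simple_graphD(1)[OF assms] this, of "gedges G - {{a, b}}"]
  have "insert {a, b} (gedges G - {{a, b}}) = gedges G" using True by auto
  with c show ?thesis using True
    by (auto simp: cut_edges_def card_graph_components delete_edge_def split: if_splits)
qed (simp add: cut_edges_def)

lemma cut_edges_subset: "cut_edges G \<subseteq> gedges G"
  by (auto simp: cut_edges_def)

lemma cut_edges_subset_spanning:
  assumes "simple_graph G" "T \<subseteq> gedges G" "reach T = reach (gedges G)"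
  shows "cut_edges G \<subseteq> T"
proof
  fix e assume e: "e \<in> cut_edges G"
  then obtain a b where ab: "e = {a, b}"
    using assms(1) cut_edges_subset by (metis simple_graph_edgeE subsetD)
  have "(a, b) \<in> reach T" using e ab assms(3) cut_edges_subset by (auto intro: reach_edge)
  moreover have "(a, b) \<notin> reach (gedges G - {e})"
    using e ab cut_edges_iff[OF assms(1), of a b] by simp
  ultimately show "e \<in> T" using reach_mono[of T "gedges G - {e}"] assms(2) by blast
qed

text \<open>If the walk from a to b had to pass a cut edge {c, d}, then its remaining pieces and {a,
  b} would join c and d without that edge. As {a, b} is no cut edge, it differs from {c, d}. The cut
  edges are removed one at a time.\<close>

lemma reach_Diff_cut_edges:
  assumes G: "simple_graph G" and F: "F \<subseteq> gedges G"
    and ab: "{a, b} \<in> gedges G" "{a, b} \<notin> cut_edges G" and r: "(a, b) \<in> reach F"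
  shows "(a, b) \<in> reach (F - cut_edges G)"
proof -
  have "(a, b) \<in> reach (F - B)" if "finite B" "B \<subseteq> cut_edges G" for B
    using that
  proof (induction B rule: finite_induct)
    case empty
    show ?case using r by simp
  next
    case (insert e B)
    obtain c d where e: "e = {c, d}"
      using insert.prems G cut_edges_subset by (metis insert_subset simple_graph_edgeE subsetD)
    let ?F = "F - insert e B"
    have cut: "(c, d) \<notin> reach (gedges G - {e})"
      using insert.prems e cut_edges_iff[OF G, of c d] by simp
    have "F - B \<subseteq> insert e ?F" by auto
    then have "(a, b) \<in> reach (insert {c, d} ?F)"
      using insert.IH insert.prems e reach_mono[of "F - B" "insert e ?F"] by auto
    moreover have False if cr: "(a, c) \<in> reach ?F \<and> (d, b) \<in> reach ?F \<or>
      (a, d) \<in> reach ?F \<and> (c, b) \<in> reach ?F"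
    proof -
      have "{a, b} \<in> gedges G - {e}" using ab insert.prems by auto
      then have "(a, b) \<in> reach (gedges G - {e})" by (rule reach_edge)
      moreover have "reach ?F \<subseteq> reach (gedges G - {e})" using F by (intro reach_mono) auto
      ultimately show False using cr cut by (meson reach_sym reach_trans subsetD)
    qed
    ultimately show ?case using reach_insert[of a b c d ?F] by blast
  qed
  moreover have "finite (cut_edges G)"
    using simple_graphD(2)[OF G] cut_edges_subset by (rule rev_finite_subset)
  ultimately show ?thesis by simp
qed

text \<open>A spanning tree must enter each component of \<open>G - v\<close> through an edge at \<open>v\<close>.\<close>

lemma obligatory_branch_degree:
  assumes G: "simple_graph G" and T: "tree_edges G T" and v: "v \<in> obligatory_branches G"
  shows "card {e\<in>T. v \<in> e} > 2"
proof -
  let ?Gv = "delete_vertex G v"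
  let ?N = "{u. {u, v} \<in> T}"
  have vG: "v \<in> gverts G" and alpha: "3 \<le> alpha G v"
    using v by (auto simp: obligatory_branches_def)
  have TG: "T \<subseteq> gedges G" using T by (simp add: tree_edges_def)
  have NG: "?N \<subseteq> gverts G - {v}" using TG simple_graphD(5)[OF G] by blast
  then have finN: "finite ?N" using simple_graphD(1)[OF G] by (meson finite_Diff finite_subset)
  \<comment> \<open>On a walk from v to w, the vertex after the last visit to v is a neighbour u of
    v in \<open>T\<close>, and the rest of the walk avoids v.\<close>
  have gate: "\<exists>u\<in>?N. (w, u) \<in> reach (gedges ?Gv)"
    if "(v, w) \<in> reach T" "w \<noteq> v" for w
    using that
  proof (induction rule: reach_induct)
    case (step c d)
    show ?case
    proof (cases "c = v")
      case True
      then have "d \<in> ?N" using step by (simp add: insert_commute)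
      then show ?thesis by (intro bexI[of _ d]) auto
    next
      case False
      then obtain u where u: "u \<in> ?N" "(c, u) \<in> reach (gedges ?Gv)" using step by blast
      have "{c, d} \<in> gedges ?Gv" using step False TG by (auto simp: delete_vertex_def)
      then show ?thesis using u by (meson reach_edge reach_sym reach_trans)
    qed
  qed simp
  have "comp_of (gverts ?Gv) (gedges ?Gv) ` gverts ?Gv \<subseteq> comp_of (gverts ?Gv) (gedges ?Gv) ` ?N"
  proof
    fix C assume "C \<in> comp_of (gverts ?Gv) (gedges ?Gv) ` gverts ?Gv"
    then obtain w where w: "w \<in> gverts ?Gv" "C = comp_of (gverts ?Gv) (gedges ?Gv) w" by blast
    then have "w \<in> gverts G" "w \<noteq> v" by (auto simp: delete_vertex_def)
    then obtain u where u: "u \<in> ?N" "(w, u) \<in> reach (gedges ?Gv)"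
      using gate[of w] T vG by (auto simp: tree_edges_def)
    then have "u \<in> gverts ?Gv" using NG by (auto simp: delete_vertex_def)
    then show "C \<in> comp_of (gverts ?Gv) (gedges ?Gv) ` ?N"
      using u w comp_of_eq_iff[of w "gverts ?Gv" u "gedges ?Gv"] by blast
  qed
  then have "alpha G v \<le> card (comp_of (gverts ?Gv) (gedges ?Gv) ` ?N)"
    unfolding alpha_def card_graph_components using finN by (intro card_mono) auto
  also have "\<dots> \<le> card ?N" using finN by (rule card_image_le)
  also have "\<dots> = card ((\<lambda>u. {u, v}) ` ?N)"
    by (intro card_image[symmetric] inj_onI) (auto simp: doubleton_eq_iff)
  also have "\<dots> \<le> card {e\<in>T. v \<in> e}"
    using TG simple_graphD(2)[OF G] by (intro card_mono) (auto intro: finite_subset)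
  finally show ?thesis using alpha by simp
qed

section \<open>The decomposed graph\<close>

text \<open>The projection that merges all copies of a vertex. It recovers each edge from its image,
  which makes \<open>split_edge\<close> injective and takes walks back to \<open>G\<close>.\<close>

primrec split_base :: "'v split_vertex \<Rightarrow> 'v" where
  "split_base (Orig v) = v"
| "split_base (Copy v C) = v"

lemma split_base_split_end [simp]: "split_base (split_end G u v) = u"
  by (simp add: split_end_def)

lemma split_edge_doubleton: "split_edge G {a, b} = {split_end G a b, split_end G b a}"
  by (auto simp: split_edge_def doubleton_eq_iff)

lemma split_base_image_split_edge:
  assumes "simple_graph G" "e \<in> gedges G"
  shows "split_base ` split_edge G e = e"
proof -
  obtain a b where "e = {a, b}" using assms by (elim simple_graph_edgeE)
  then show ?thesis by (simp add: split_edge_doubleton)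
qed

lemma inj_on_split_edge:
  assumes "simple_graph G"
  shows "inj_on (split_edge G) (gedges G)"
  using split_base_image_split_edge[OF assms] by (metis inj_onI)

lemma Orig_mem_split_edge_iff:
  assumes "simple_graph G" "e \<in> gedges G"
  shows "Orig v \<in> split_edge G e \<longleftrightarrow> v \<in> e \<and> v \<notin> obligatory_branches G"
proof -
  obtain a b where "e = {a, b}" using assms by (elim simple_graph_edgeE)
  then show ?thesis by (auto simp: split_edge_doubleton split_end_def split: if_splits)
qed

text \<open>The definition subtracts the images of the cut edges; as \<open>split_edge\<close> is
  injective, no other edge disappears with them.\<close>

lemma gedges_full_decomposition:
  assumes "simple_graph G"
  shows "gedges (full_decomposition G) = split_edge G ` (gedges G - cut_edges G)"
  using inj_on_image_set_diff[OF inj_on_split_edge[OF assms], of "gedges G" "cut_edges G"]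
    cut_edges_subset[of G]
  by (auto simp: full_decomposition_def obligatory_decomposition_def)

lemma gverts_full_decomposition:
  "gverts (full_decomposition G) = Orig ` (gverts G - obligatory_branches G) \<union>
    {Copy v C | v C. v \<in> obligatory_branches G \<and>
      C \<in> component_verts (delete_vertex G v) ` (gverts G - {v})}"
proof -
  have "gverts ` graph_components (delete_vertex G v) =
    component_verts (delete_vertex G v) ` (gverts G - {v})" for v
    by (simp add: graph_components_def image_image induced_graph_def) (simp add: delete_vertex_def)
  moreover have "{Copy v (gverts C) | v C. v \<in> obligatory_branches G \<and>
        C \<in> graph_components (delete_vertex G v)} =
      {Copy v C | v C. v \<in> obligatory_branches G \<and>
        C \<in> gverts ` graph_components (delete_vertex G v)}"
    by blast
  ultimately show ?thesis
    by (simp add: full_decomposition_def obligatory_decomposition_def)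
qed

lemma simple_graph_full_decomposition:
  assumes "simple_graph G"
  shows "simple_graph (full_decomposition G)"
  unfolding simple_graph_def
proof (intro conjI ballI)
  have "gverts (full_decomposition G) \<subseteq> Orig ` gverts G \<union>
    (\<Union>v\<in>gverts G. Copy v ` component_verts (delete_vertex G v) ` gverts G)"
    by (auto simp: gverts_full_decomposition obligatory_branches_def)
  moreover have "finite \<dots>" using simple_graphD(1)[OF assms] by simp
  ultimately show "finite (gverts (full_decomposition G))" by (rule finite_subset)
next
  have mem: "split_end G a b \<in> gverts (full_decomposition G)"
    if "a \<in> gverts G" "b \<in> gverts G" "a \<noteq> b" for a b
    using that by (auto simp: gverts_full_decomposition split_end_def)
  fix e assume "e \<in> gedges (full_decomposition G)"
  then obtain a b where e: "e = {split_end G a b, split_end G b a}"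
    and ab: "a \<in> gverts G" "b \<in> gverts G" "a \<noteq> b"
    using assms by (auto simp: gedges_full_decomposition split_edge_doubleton
        elim!: simple_graph_edgeE)
  then show "e \<subseteq> gverts (full_decomposition G)" using mem by auto
  have "split_end G a b \<noteq> split_end G b a" using ab(3) by (metis split_base_split_end)
  then show "card e = 2" using e by simp
qed

section \<open>Transport of walks and forests between the graph and its decomposition\<close>

lemma reach_split_base:
  assumes "simple_graph G" "F \<subseteq> gedges G" "(x, y) \<in> reach (split_edge G ` F)"
  shows "(split_base x, split_base y) \<in> reach F"
  using assms(3)
proof (induction rule: reach_induct)
  case (step c d)
  then obtain e where e: "e \<in> F" "{c, d} = split_edge G e" by blast
  then have "split_base ` {c, d} = e"
    using split_base_image_split_edge[OF assms(1), of e] assms(2) by auto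
  then show ?case using step e(1) by (auto intro: reach_trans reach_edge)
qed simp

text \<open>Copies of u are indexed by the components of \<open>G - u\<close>, so vertices joined
  without passing u select the same copy.\<close>

lemma split_end_cong:
  assumes "(v, w) \<in> reach {e\<in>gedges G. u \<notin> e}"
  shows "split_end G u v = split_end G u w"
proof -
  have "component_verts (delete_vertex G u) v = component_verts (delete_vertex G u) w"
    using assms unfolding component_verts_eq_comp_of comp_of_def delete_vertex_def
    by (auto intro: reach_trans reach_sym)
  then show ?thesis by (simp add: split_end_def)
qed

text \<open>The edge \<open>{a, b}\<close> closes a simple path from \<open>a\<close> to \<open>b\<close> to a cycle. The two neighbours on
  it of any vertex \<open>t\<close> lie in the same component of \<open>G - t\<close>, so both edges of the cycle
  at \<open>t\<close> are attached to the same copy of \<open>t\<close>.\<close>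

lemma reach_split_edge_lift:
  assumes G: "simple_graph G" and F: "F \<subseteq> gedges G" and ab: "{a, b} \<in> gedges G"
    and r: "(a, b) \<in> reach F"
  shows "(split_end G a b, split_end G b a) \<in> reach (split_edge G ` F)"
proof -
  have "a \<noteq> b" using simple_graphD(5)[OF G ab] by simp
  obtain p where p: "p \<noteq> []" "hd p = a" "last p = b" "distinct p"
    and s: "successively (\<lambda>x y. {x, y} \<in> F) p"
    using r by (elim reach_simple_path)
  have avoid: "(hd q, last q) \<in> reach {e\<in>gedges G. t \<notin> e}"
    if "successively (\<lambda>x y. {x, y} \<in> F) q" "q \<noteq> []" "t \<notin> set q" for q t
  proof -
    have "{e\<in>F. t \<notin> e} \<subseteq> {e\<in>gedges G. t \<notin> e}" using F by blast
    then show ?thesis using successively_imp_reach_avoiding[OF that] reach_mono by blast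
  qed
  \<comment> \<open>The target \<open>split_end G u (last ps)\<close> is the copy of u at which the
    path arrives from its predecessor.\<close>
  have lift: "(split_end G a b, split_end G u (last ps)) \<in> reach (split_edge G ` F)"
    if "p = ps @ u # qs" "ps \<noteq> []" for ps u qs
    using that
  proof (induction ps arbitrary: u qs rule: rev_induct)
    case (snoc t ps)
    have s': "successively (\<lambda>x y. {x, y} \<in> F) (u # qs)" "{t, u} \<in> F"
      "successively (\<lambda>x y. {x, y} \<in> F) ps"
      using s snoc.prems(1) by (auto simp: successively_append_iff successively_Cons)
    have "t \<notin> set (u # qs)" "t \<notin> set ps" using p(4) snoc.prems(1) by auto
    have last: "last (u # qs) = b" using p(3) snoc.prems(1) by simp
    have ub: "(u, b) \<in> reach {e\<in>gedges G. t \<notin> e}"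
      using avoid[OF s'(1) _ \<open>t \<notin> set (u # qs)\<close>] last by simp
    \<comment> \<open>The path has to leave t through the copy by which it came: u and the
      predecessor of t are joined in \<open>G - t\<close> by going on to b, along {b, a}, and
      forward from a. At the start t = a, the copy is the one on the side of b.\<close>
    have "(split_end G a b, split_end G t u) \<in> reach (split_edge G ` F)"
    proof (cases "ps = []")
      case True
      then have "t = a" using p(2) snoc.prems(1) by simp
      then show ?thesis using split_end_cong[OF ub] by simp
    next
      case False
      then have "hd ps = a" using p(2) snoc.prems(1) by simp
      then have "(a, last ps) \<in> reach {e\<in>gedges G. t \<notin> e}"
        using avoid[OF s'(3) False \<open>t \<notin> set ps\<close>] by simp
      moreover have "(b, a) \<in> reach {e\<in>gedges G. t \<notin> e}"
      proof (rule reach_edge)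
        have "t \<noteq> b" using \<open>t \<notin> set (u # qs)\<close> last by (metis last_in_set list.distinct(1))
        moreover have "t \<noteq> a" using \<open>t \<notin> set ps\<close> \<open>hd ps = a\<close> False by auto
        ultimately show "{b, a} \<in> {e\<in>gedges G. t \<notin> e}" using ab by (simp add: insert_commute)
      qed
      ultimately have "(u, last ps) \<in> reach {e\<in>gedges G. t \<notin> e}"
        using ub by (meson reach_sym reach_trans)
      then have "split_end G t u = split_end G t (last ps)" by (rule split_end_cong)
      then show ?thesis using snoc.IH[of t "u # qs"] snoc.prems(1) False by simp
    qed
    also have "(split_end G t u, split_end G u t) \<in> reach (split_edge G ` F)"
      using s'(2) split_edge_doubleton[of G t u] by (metis imageI reach_edge)
    finally show ?case by simp
  qed simp
  define ps where "ps = butlast p"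
  have ps: "p = ps @ [b]" using p(1,3) by (simp add: ps_def append_butlast_last_id flip: p(3))
  have "ps \<noteq> []" using ps p(2) \<open>a \<noteq> b\<close> by auto
  have "hd ps = a" using ps p(2) \<open>ps \<noteq> []\<close> by simp
  \<comment> \<open>At the other end, the predecessor of b is joined to a without passing b, so the
    path arrives at the copy of b that belongs to {a, b}.\<close>
  then have "(a, last ps) \<in> reach {e\<in>gedges G. b \<notin> e}"
    using avoid[of ps b] s p(4) \<open>ps \<noteq> []\<close> by (auto simp: ps successively_append_iff)
  then show ?thesis using lift[OF ps \<open>ps \<noteq> []\<close>] by (simp add: split_end_cong)
qed

text \<open>From \<open>T\<close> to \<open>T'\<close>, merging gives acyclicity (a redundant edge
  of \<open>T'\<close> would yield one of \<open>T\<close>) and lifting gives spanning; from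
  \<open>T'\<close> to \<open>T\<close> the two exchange roles. Before each lift,
  \<open>reach_Diff_cut_edges\<close> frees the walk from cut edges, which have no counterpart in
  \<open>T'\<close>.\<close>

lemma spanning_forest_iff_split:
  assumes G: "simple_graph G" and T: "cut_edges G \<subseteq> T" "T \<subseteq> gedges G"
  defines "T' \<equiv> split_edge G ` (T - cut_edges G)"
  shows "forest T \<and> reach T = reach (gedges G) \<longleftrightarrow>
    forest T' \<and> reach T' = reach (gedges (full_decomposition G))"
proof -
  let ?B = "cut_edges G" and ?D = "full_decomposition G"
  note D = gedges_full_decomposition[OF G]
  have T'D: "T' \<subseteq> gedges ?D" unfolding T'_def D using T(2) by blast
  have T'_Diff: "T' - {split_edge G e} = split_edge G ` (T - ?B - {e})" if "e \<in> gedges G" for e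
    unfolding T'_def using inj_on_split_edge[OF G] that T(2)
    by (auto simp: inj_on_def)
  show ?thesis
  proof
    assume L: "forest T \<and> reach T = reach (gedges G)"
    have "forest T'"
      unfolding forest_def
    proof (intro allI impI notI)
      fix x y assume xy: "{x, y} \<in> T'" and r: "(x, y) \<in> reach (T' - {{x, y}})"
      then obtain e where e: "e \<in> T" "{x, y} = split_edge G e" unfolding T'_def by blast
      have "split_base ` split_edge G e = e"
        using e(1) T(2) by (intro split_base_image_split_edge[OF G]) auto
      then have base: "e = {split_base x, split_base y}" by (simp flip: e(2))
      have "(split_base x, split_base y) \<in> reach (T - ?B - {e})"
      proof (rule reach_split_base[OF G])
        show "T - ?B - {e} \<subseteq> gedges G" using T(2) by blast
        show "(x, y) \<in> reach (split_edge G ` (T - ?B - {e}))"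
          using r e(1) T(2) by (subst T'_Diff[symmetric]) (auto simp flip: e(2))
      qed
      then have "(split_base x, split_base y) \<in> reach (T - {e})"
        using reach_mono[of "T - ?B - {e}" "T - {e}"] by blast
      then show False using L e(1) base by (simp add: forest_def)
    qed
    moreover have "reach (gedges ?D) \<subseteq> reach T'"
    proof (rule reach_subsetI)
      fix x y assume "{x, y} \<in> gedges ?D"
      then obtain e where e: "e \<in> gedges G" "e \<notin> ?B" "{x, y} = split_edge G e"
        unfolding D by blast
      obtain a b where "e = {a, b}" using e(1) G by (elim simple_graph_edgeE)
      with e have ab: "{a, b} \<in> gedges G" "{a, b} \<notin> ?B"
        and xy: "{x, y} = {split_end G a b, split_end G b a}"
        by (auto simp: split_edge_doubleton)
      have "(a, b) \<in> reach T" using L ab(1) by (simp add: reach_edge)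
      then have "(a, b) \<in> reach (T - ?B)" using reach_Diff_cut_edges[OF G T(2) ab] by simp
      then have "(split_end G a b, split_end G b a) \<in> reach T'"
        unfolding T'_def using T(2) ab(1) by (intro reach_split_edge_lift[OF G]) auto
      then show "(x, y) \<in> reach T'" using xy by (auto simp: doubleton_eq_iff dest: reach_sym)
    qed
    ultimately show "forest T' \<and> reach T' = reach (gedges ?D)" using reach_mono[OF T'D] by blast
  next
    assume R: "forest T' \<and> reach T' = reach (gedges ?D)"
    have "forest T"
      unfolding forest_def
    proof (intro allI impI notI)
      fix a b assume ab: "{a, b} \<in> T" and r: "(a, b) \<in> reach (T - {{a, b}})"
      have abG: "{a, b} \<in> gedges G" using ab T(2) by blast
      \<comment> \<open>An edge on a cycle is no cut edge, so {a, b} does have a counterpart in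
        \<open>T'\<close>.\<close>
      have "(a, b) \<in> reach (gedges G - {{a, b}})"
        using r reach_mono[of "T - {{a, b}}" "gedges G - {{a, b}}"] T(2) by blast
      then have nB: "{a, b} \<notin> ?B" using cut_edges_iff[OF G] by blast
      have "(a, b) \<in> reach (T - {{a, b}} - ?B)"
        using r T(2) by (intro reach_Diff_cut_edges[OF G _ abG nB]) auto
      then have "(split_end G a b, split_end G b a) \<in> reach (split_edge G ` (T - {{a, b}} - ?B))"
        using T(2) by (intro reach_split_edge_lift[OF G _ abG]) auto
      moreover have "T - {{a, b}} - ?B = T - ?B - {{a, b}}" by blast
      ultimately have "(split_end G a b, split_end G b a) \<in>
          reach (T' - {{split_end G a b, split_end G b a}})"
        using T'_Diff[OF abG] by (simp add: split_edge_doubleton)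
      moreover have "{split_end G a b, split_end G b a} \<in> T'"
        unfolding T'_def using ab nB split_edge_doubleton[of G a b] by blast
      ultimately show False using R by (simp add: forest_def)
    qed
    moreover have "reach (gedges G) \<subseteq> reach T"
    proof (rule reach_subsetI)
      fix a b assume ab: "{a, b} \<in> gedges G"
      show "(a, b) \<in> reach T"
      proof (cases "{a, b} \<in> ?B")
        case True
        then show ?thesis using T(1) by (auto intro: reach_edge)
      next
        case False
        then have "{split_end G a b, split_end G b a} \<in> gedges ?D"
          unfolding D using ab split_edge_doubleton[of G a b] by blast
        then have "(split_end G a b, split_end G b a) \<in> reach T'" using R by (simp add: reach_edge)
        moreover have "T - ?B \<subseteq> gedges G" using T(2) by blast
        ultimately have "(a, b) \<in> reach (T - ?B)"
          using reach_split_base[OF G, of "T - ?B" "split_end G a b" "split_end G b a"]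
          by (simp add: T'_def)
        then show ?thesis using reach_mono[of "T - ?B" T] by blast
      qed
    qed
    ultimately show "forest T \<and> reach T = reach (gedges G)" using reach_mono[OF T(2)] by blast
  qed
qed

lemma tree_edges_iff_spanning_forest:
  assumes "simple_graph G" "connected_graph G"
  shows "tree_edges G T \<longleftrightarrow> T \<subseteq> gedges G \<and> forest T \<and> reach T = reach (gedges G)"
proof
  assume T: "tree_edges G T"
  have "reach (gedges G) \<subseteq> reach T"
    using T simple_graphD(5)[OF assms(1)] by (intro reach_subsetI) (auto simp: tree_edges_def)
  then show "T \<subseteq> gedges G \<and> forest T \<and> reach T = reach (gedges G)"
    using T reach_mono[of T "gedges G"] by (auto simp: tree_edges_def)
next
  assume "T \<subseteq> gedges G \<and> forest T \<and> reach T = reach (gedges G)"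
  then show "tree_edges G T"
    using assms(2) by (auto simp: tree_edges_def connected_graph_def reachable_in_iff_reach)
qed

text \<open>The condition \<open>cut_edges G \<subseteq> T\<close> stands apart because the
  components contain no counterparts of cut edges and cannot enforce it.\<close>

lemma tree_edges_iff_components:
  assumes G: "simple_graph G" "connected_graph G"
  shows "tree_edges G T \<longleftrightarrow> cut_edges G \<subseteq> T \<and> T \<subseteq> gedges G \<and>
    (\<forall>H\<in>graph_components (full_decomposition G).
       tree_edges H (split_edge G ` (T - cut_edges G) \<inter> gedges H))"
proof -
  have "split_edge G ` (T - cut_edges G) \<subseteq> gedges (full_decomposition G)" if "T \<subseteq> gedges G"
    using that gedges_full_decomposition[OF G(1)] by blast
  then show ?thesis
    using tree_edges_iff_spanning_forest[OF G, of T] spanning_forest_iff_split[OF G(1), of T]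
      cut_edges_subset_spanning[OF G(1), of T]
      spanning_forest_iff_components[OF simple_graph_full_decomposition[OF G(1)],
        of "split_edge G ` (T - cut_edges G)"]
    by blast
qed

section \<open>The integer programs of the components\<close>

lemma finite_original_verts:
  assumes "simple_graph H"
  shows "finite (original_verts H)"
proof -
  have "original_verts H = Orig -` gverts H" by (auto simp: original_verts_def)
  then show ?thesis using simple_graphD(1)[OF assms] by (simp add: finite_vimageI inj_def)
qed

lemma ip_feasible_iff_tree_edges:
  assumes H: "simple_graph H" "gverts H \<noteq> {}"
  shows "ip_feasible G H x y \<longleftrightarrow>
    (\<forall>e\<in>gedges H. x e \<in> {0, 1}) \<and> (\<forall>w\<in>gverts H. y w \<in> {0, 1}) \<and>
    tree_edges H {e\<in>gedges H. x e = 1} \<and>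
    (\<forall>v\<in>original_verts H.
       int (card {e\<in>{e\<in>gedges H. x e = 1}. Orig v \<in> e}) + int (extra_degree G v)
         \<le> 2 + (int (deg G v) - 2) * y (Orig v))"
proof (cases "\<forall>e\<in>gedges H. x e \<in> {0, 1}")
  case True
  have "(\<Sum>e\<in>{e\<in>gedges H. Orig v \<in> e}. x e) =
    int (card {e\<in>{e\<in>gedges H. x e = 1}. Orig v \<in> e})" for v
  proof -
    have "(\<Sum>e\<in>{e\<in>gedges H. Orig v \<in> e}. x e) =
        int (card {e\<in>{e\<in>gedges H. Orig v \<in> e}. x e = 1})"
      using True simple_graphD(2)[OF H(1)] by (intro sum_binary) auto
    also have "{e\<in>{e\<in>gedges H. Orig v \<in> e}. x e = 1} =
        {e\<in>{e\<in>gedges H. x e = 1}. Orig v \<in> e}" by blast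
    finally show ?thesis .
  qed
  moreover have "x e \<in> {0, 1}" if "e \<in> gedges H" for e using True that by blast
  ultimately show ?thesis
    using subtour_constraints_iff_tree_edges[OF H, of x] True unfolding ip_feasible_def by auto
qed (auto simp: ip_feasible_def)

lemma ip_objective_eq_card:
  assumes "simple_graph H" "\<And>w. w \<in> gverts H \<Longrightarrow> y w \<in> {0, 1}"
  shows "ip_objective H y = int (card {v\<in>original_verts H. y (Orig v) = 1})"
  unfolding ip_objective_def using finite_original_verts[OF assms(1)]
  by (rule sum_binary) (use assms(2) in \<open>simp add: original_verts_def\<close>)

text \<open>Feasibility leaves \<open>x\<close> and \<open>y\<close> arbitrary outside
  \<open>H\<close>, so solutions may be infinite in number; their objective values are still
  bounded, as the \<open>Min\<close> in \<open>ip_value\<close> demands.\<close>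

lemma finite_ip_objectives:
  assumes "simple_graph H"
  shows "finite {ip_objective H y | x y. ip_feasible G H x y}"
proof -
  have "ip_objective H y \<in> int ` {..card (original_verts H)}" if "ip_feasible G H x y" for x y
  proof -
    have "ip_objective H y = int (card {v\<in>original_verts H. y (Orig v) = 1})"
      using that by (intro ip_objective_eq_card[OF assms]) (auto simp: ip_feasible_def)
    moreover have "card {v\<in>original_verts H. y (Orig v) = 1} \<le> card (original_verts H)"
      using finite_original_verts[OF assms] by (intro card_mono) auto
    ultimately show ?thesis by simp
  qed
  then have "{ip_objective H y | x y. ip_feasible G H x y} \<subseteq> int ` {..card (original_verts H)}"
    by blast
  then show ?thesis by (rule finite_subset) simp
qed

lemma ip_optimal_imp_ip_value:
  assumes "simple_graph H" "ip_optimal G H x y"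
  shows "ip_value G H = ip_objective H y"
  unfolding ip_value_def
  by (rule Min_eqI) (use finite_ip_objectives[OF assms(1)] assms(2) in \<open>auto simp: ip_optimal_def\<close>)

lemma exists_ip_optimal:
  assumes "simple_graph H" "ip_feasible G H x y"
  shows "\<exists>x y. ip_optimal G H x y"
proof -
  let ?O = "{ip_objective H y | x y. ip_feasible G H x y}"
  have "Min ?O \<in> ?O" using assms by (intro Min_in finite_ip_objectives) auto
  then obtain x y where "ip_feasible G H x y" "Min ?O = ip_objective H y" by blast
  then have "ip_optimal G H x y"
    using finite_ip_objectives[OF assms(1)] unfolding ip_optimal_def
    by (metis (mono_tags, lifting) Min_le mem_Collect_eq)
  then show ?thesis by blast
qed

section \<open>Degrees and the number of branch vertices\<close>

lemma deg_eq_extra_degree_plus: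
  assumes G: "simple_graph G" and T: "cut_edges G \<subseteq> gedges T" "gedges T \<subseteq> gedges G"
    and H: "H \<in> graph_components (full_decomposition G)" and v: "v \<in> original_verts H"
  shows "deg T v = extra_degree G v +
    card {e\<in>split_edge G ` (gedges T - cut_edges G) \<inter> gedges H. Orig v \<in> e}"
proof -
  let ?B = "cut_edges G"
  let ?N = "{e\<in>gedges T - ?B. v \<in> e}"
  have D: "simple_graph (full_decomposition G)" using G by (rule simple_graph_full_decomposition)
  have vH: "Orig v \<in> gverts H" using v by (simp add: original_verts_def)
  then have "Orig v \<in> gverts (full_decomposition G)" using component_props(2)[OF H] by blast
  then have vL: "v \<notin> obligatory_branches G" by (auto simp: gverts_full_decomposition)
  \<comment> \<open>As v is not obligatory, the images of all edges at v share the one vertex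
    \<open>Orig v\<close>; hence those of the non-cut edges all lie in the component
    \<open>H\<close>.\<close>
  have "split_edge G ` ?N = {e\<in>split_edge G ` (gedges T - ?B) \<inter> gedges H. Orig v \<in> e}"
  proof (intro equalityI subsetI)
    fix e' assume "e' \<in> split_edge G ` ?N"
    then obtain e where e: "e \<in> gedges T - ?B" "v \<in> e" "e' = split_edge G e" by blast
    then have eG: "e \<in> gedges G" using T(2) by blast
    then have "Orig v \<in> e'" using e(2,3) vL Orig_mem_split_edge_iff[OF G eG] by simp
    moreover have "e' \<in> gedges (full_decomposition G)"
      using e eG gedges_full_decomposition[OF G] by blast
    ultimately have "e' \<in> gedges H" using component_edge_closed(1)[OF H _ _ D] vH by blast
    then show "e' \<in> {e\<in>split_edge G ` (gedges T - ?B) \<inter> gedges H. Orig v \<in> e}"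
      using e \<open>Orig v \<in> e'\<close> by blast
  next
    fix e' assume "e' \<in> {e\<in>split_edge G ` (gedges T - ?B) \<inter> gedges H. Orig v \<in> e}"
    then obtain e where e: "e \<in> gedges T - ?B" "e' = split_edge G e" "Orig v \<in> split_edge G e"
      by blast
    then have "e \<in> gedges G" using T(2) by blast
    then have "v \<in> e" using Orig_mem_split_edge_iff[OF G] e(3) by blast
    then show "e' \<in> split_edge G ` ?N" using e by blast
  qed
  moreover have "inj_on (split_edge G) ?N"
    using inj_on_split_edge[OF G] by (rule inj_on_subset) (use T(2) in blast)
  then have "card (split_edge G ` ?N) = card ?N" by (rule card_image)
  ultimately have "card {e\<in>split_edge G ` (gedges T - ?B) \<inter> gedges H. Orig v \<in> e} = card ?N"
    by simp
  moreover have "{e\<in>gedges T. v \<in> e} = {e\<in>?B. v \<in> e} \<union> ?N" using T(1) by blast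
  moreover have "finite (gedges T)" using T(2) simple_graphD(2)[OF G] by (rule finite_subset)
  then have "finite {e\<in>?B. v \<in> e}" "finite ?N"
    by (rule rev_finite_subset, use T(1) in blast)+
  then have "card ({e\<in>?B. v \<in> e} \<union> ?N) = card {e\<in>?B. v \<in> e} + card ?N"
    by (intro card_Un_disjoint) auto
  ultimately show ?thesis by (simp add: deg_def extra_degree_def)
qed

text \<open>A vertex that is not obligatory occurs as \<open>Orig v\<close> in exactly one
  component, so the sum counts it once; every obligatory branch counts by
  \<open>obligatory_branch_degree\<close>.\<close>

lemma card_branch_vertices:
  assumes G: "simple_graph G" "connected_graph G" and T: "is_spanning_tree T G"
  shows "card (branch_vertices T) = card (obligatory_branches G) +
    (\<Sum>H\<in>graph_components (full_decomposition G). card {v\<in>original_verts H. deg T v > 2})"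
proof -
  let ?L = "obligatory_branches G" and ?D = "full_decomposition G"
  let ?C = "graph_components ?D" and ?N = "\<lambda>H. {v\<in>original_verts H. deg T v > 2}"
  have D: "simple_graph ?D" using G(1) by (rule simple_graph_full_decomposition)
  have TG: "gverts T = gverts G" "tree_edges G (gedges T)"
    using is_spanning_tree_iff_tree_edges[OF G(1)] G(2) T by (auto simp: connected_graph_def)
  have finC: "finite ?C" using simple_graphD(1)[OF D] by (simp add: graph_components_def)
  have finN: "finite (?N H)" if "H \<in> ?C" for H
    using finite_original_verts[OF component_simple_graph[OF that D]] by simp
  have orig: "v \<in> gverts G - ?L \<longleftrightarrow> (\<exists>H\<in>?C. v \<in> original_verts H)" for v
  proof -
    have "v \<in> gverts G - ?L \<longleftrightarrow> Orig v \<in> gverts ?D" by (auto simp: gverts_full_decomposition)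
    also have "\<dots> \<longleftrightarrow> (\<exists>H\<in>?C. Orig v \<in> gverts H)"
      using component_exists component_props(2) by (metis subsetD)
    finally show ?thesis by (simp add: original_verts_def)
  qed
  have "branch_vertices T = ?L \<union> (\<Union>H\<in>?C. ?N H)"
  proof (intro equalityI subsetI)
    fix v assume "v \<in> branch_vertices T"
    then show "v \<in> ?L \<union> (\<Union>H\<in>?C. ?N H)" using orig[of v] TG(1) by (auto simp: branch_vertices_def)
  next
    fix v assume v: "v \<in> ?L \<union> (\<Union>H\<in>?C. ?N H)"
    show "v \<in> branch_vertices T"
    proof (cases "v \<in> ?L")
      case True
      then show ?thesis using obligatory_branch_degree[OF G(1) TG(2) True] TG(1)
        by (simp add: branch_vertices_def deg_def obligatory_branches_def)
    next
      case False
      then show ?thesis using v orig[of v] TG(1) by (auto simp: branch_vertices_def)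
    qed
  qed
  moreover have "finite ?L" using simple_graphD(1)[OF G(1)] by (simp add: obligatory_branches_def)
  moreover have "?L \<inter> (\<Union>H\<in>?C. ?N H) = {}" using orig by blast
  ultimately have "card (branch_vertices T) = card ?L + card (\<Union>H\<in>?C. ?N H)"
    using finC finN by (simp add: card_Un_disjoint)
  also have "card (\<Union>H\<in>?C. ?N H) = (\<Sum>H\<in>?C. card (?N H))"
  proof (rule card_UN_disjoint[OF finC])
    show "\<forall>H\<in>?C. \<forall>H'\<in>?C. H \<noteq> H' \<longrightarrow> ?N H \<inter> ?N H' = {}"
    proof (intro ballI impI)
      fix H H' assume "H \<in> ?C" "H' \<in> ?C" "H \<noteq> H'"
      then show "?N H \<inter> ?N H' = {}"
        using component_unique[of H ?D H'] by (auto simp: original_verts_def)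
    qed
  qed (use finN in blast)
  finally show ?thesis .
qed

section \<open>Passage between spanning trees and feasible solutions\<close>

lemma ip_feasible_of_spanning_tree:
  assumes G: "simple_graph G" "connected_graph G" and T: "is_spanning_tree T G"
    and H: "H \<in> graph_components (full_decomposition G)"
  obtains x y where "ip_feasible G H x y"
    "ip_objective H y = int (card {v\<in>original_verts H. deg T v > 2})"
proof
  let ?T' = "split_edge G ` (gedges T - cut_edges G)"
  let ?x = "\<lambda>e. if e \<in> ?T' then 1 else 0 :: int"
  \<comment> \<open>The indicator of the branch vertices of \<open>T\<close>;
    \<open>split_base\<close> extends it to the copies, where the program asks for a 0/1 value that
    the objective does not see.\<close>
  let ?y = "\<lambda>w. if deg T (split_base w) > 2 then 1 else 0 :: int"
  have sH: "simple_graph H"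
    using component_simple_graph[OF H] simple_graph_full_decomposition[OF G(1)] .
  have "tree_edges G (gedges T)"
    using is_spanning_tree_iff_tree_edges[OF G(1)] G(2) T by (auto simp: connected_graph_def)
  then have T': "cut_edges G \<subseteq> gedges T" "gedges T \<subseteq> gedges G" "tree_edges H (?T' \<inter> gedges H)"
    using tree_edges_iff_components[OF G] H by auto
  have x1: "{e\<in>gedges H. ?x e = 1} = ?T' \<inter> gedges H" by auto
  show "ip_feasible G H ?x ?y"
    unfolding ip_feasible_iff_tree_edges[OF sH component_props(3)[OF H]] x1
  proof (intro conjI ballI)
    fix v assume v: "v \<in> original_verts H"
    \<comment> \<open>For \<open>y = 1\<close> the right-hand side is the degree in
      \<open>G\<close>, which bounds the degree in \<open>T\<close>; for \<open>y = 0\<close> it is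
      2, and v is no branch vertex.\<close>
    have "deg T v \<le> deg G v"
      using T'(2) simple_graphD(2)[OF G(1)] unfolding deg_def by (intro card_mono) auto
    then show "int (card {e\<in>?T' \<inter> gedges H. Orig v \<in> e}) + int (extra_degree G v)
        \<le> 2 + (int (deg G v) - 2) * ?y (Orig v)"
      using deg_eq_extra_degree_plus[OF G(1) T'(1,2) H v] by auto
  qed (use T'(3) in auto)
  show "ip_objective H ?y = int (card {v\<in>original_verts H. deg T v > 2})"
  proof -
    have "{v\<in>original_verts H. ?y (Orig v) = 1} = {v\<in>original_verts H. deg T v > 2}" by auto
    then show ?thesis using ip_objective_eq_card[OF sH, of ?y] by simp
  qed
qed

text \<open>Only an inequality is available, since a feasible \<open>y\<close> may be 1 at a vertex
  of degree at most 2. On the other hand \<open>y = 0\<close> bounds the degree by 2, so no branch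
  vertex goes unpaid.\<close>

lemma assembled_graph_spanning_tree:
  assumes G: "simple_graph G" "connected_graph G"
    and feas: "\<And>H. H \<in> graph_components (full_decomposition G) \<Longrightarrow> ip_feasible G H (x H) (y H)"
  shows "is_spanning_tree (assembled_graph G x) G"
    and "\<And>H. H \<in> graph_components (full_decomposition G) \<Longrightarrow>
      int (card {v\<in>original_verts H. deg (assembled_graph G x) v > 2}) \<le> ip_objective H (y H)"
proof -
  let ?D = "full_decomposition G" and ?T = "assembled_graph G x"
  let ?T' = "split_edge G ` (gedges ?T - cut_edges G)"
  have D: "simple_graph ?D" using G(1) by (rule simple_graph_full_decomposition)
  have T: "gverts ?T = gverts G" "cut_edges G \<subseteq> gedges ?T" "gedges ?T \<subseteq> gedges G"
    using cut_edges_subset[of G] by (auto simp: assembled_graph_def)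
  \<comment> \<open>An edge of the decomposed graph lies in only one component, so the existential
    quantifier in \<open>assembled_graph\<close> can refer to none but \<open>H\<close>.\<close>
  have x1: "?T' \<inter> gedges H = {e\<in>gedges H. x H e = 1}" if H: "H \<in> graph_components ?D" for H
  proof (intro equalityI subsetI)
    fix e' assume e': "e' \<in> ?T' \<inter> gedges H"
    then obtain e where "e \<in> gedges ?T" "e \<notin> cut_edges G" "e' = split_edge G e" by blast
    then obtain H' where H': "H' \<in> graph_components ?D" "e' \<in> gedges H'" "x H' e' = 1"
      by (auto simp: assembled_graph_def)
    then have "H' = H" using component_edge_unique[OF H'(1) H H'(2) _ D] e' by blast
    then show "e' \<in> {e\<in>gedges H. x H e = 1}" using H' by simp
  next
    fix e' assume e': "e' \<in> {e\<in>gedges H. x H e = 1}"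
    then have "e' \<in> gedges ?D" using component_props(1)[OF H] by blast
    then obtain e where e: "e \<in> gedges G" "e \<notin> cut_edges G" "e' = split_edge G e"
      unfolding gedges_full_decomposition[OF G(1)] by blast
    then have "e \<in> gedges ?T" using e' H by (auto simp: assembled_graph_def)
    then show "e' \<in> ?T' \<inter> gedges H" using e e' by blast
  qed
  have feas': "(\<forall>w\<in>gverts H. y H w \<in> {0, 1}) \<and> tree_edges H (?T' \<inter> gedges H) \<and>
      (\<forall>v\<in>original_verts H. int (deg ?T v) \<le> 2 + (int (deg G v) - 2) * y H (Orig v))"
    if H: "H \<in> graph_components ?D" for H
    using feas[OF H] deg_eq_extra_degree_plus[OF G(1) T(2,3) H]
    unfolding ip_feasible_iff_tree_edges[OF component_simple_graph[OF H D] component_props(3)[OF H]]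
    by (simp add: x1[OF H] add.commute)
  then have "tree_edges G (gedges ?T)" using tree_edges_iff_components[OF G] T by blast
  then show "is_spanning_tree ?T G"
    using is_spanning_tree_iff_tree_edges[OF G(1)] G(2) T(1) by (auto simp: connected_graph_def)
  fix H assume H: "H \<in> graph_components ?D"
  have sH: "simple_graph H" using component_simple_graph[OF H D] .
  have "{v\<in>original_verts H. deg ?T v > 2} \<subseteq> {v\<in>original_verts H. y H (Orig v) = 1}"
  proof (intro subsetI CollectI conjI)
    fix v assume v: "v \<in> {v\<in>original_verts H. deg ?T v > 2}"
    then show "v \<in> original_verts H" by simp
    then have "y H (Orig v) \<in> {0, 1}"
      "int (deg ?T v) \<le> 2 + (int (deg G v) - 2) * y H (Orig v)"
      using feas'[OF H] by (auto simp: original_verts_def)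
    then show "y H (Orig v) = 1" using v by auto
  qed
  then have "card {v\<in>original_verts H. deg ?T v > 2} \<le> card {v\<in>original_verts H. y H (Orig v) = 1}"
    using finite_original_verts[OF sH] by (intro card_mono) auto
  then show "int (card {v\<in>original_verts H. deg ?T v > 2}) \<le> ip_objective H (y H)"
    using ip_objective_eq_card[OF sH, of "y H"] feas'[OF H] by auto
qed

lemma exists_spanning_tree:
  assumes G: "simple_graph G" "connected_graph G"
  obtains T where "is_spanning_tree T G"
proof -
  obtain F where F: "F \<subseteq> gedges G" "forest F" "reach F = reach (gedges G)"
    using exists_spanning_forest[OF simple_graphD(2)[OF G(1)]] .
  then have "tree_edges G F" using tree_edges_iff_spanning_forest[OF G] by blast
  then have "is_spanning_tree \<lparr>gverts = gverts G, gedges = F\<rparr> G"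
    using is_spanning_tree_iff_tree_edges[OF G(1)] G(2) by (auto simp: connected_graph_def)
  then show thesis using that by blast
qed

lemma min_branch_optimal_imp_value:
  assumes "simple_graph G" "min_branch_optimal G T"
  shows "min_branch_value G = card (branch_vertices T)"
proof -
  have "card (branch_vertices T') \<le> card (gverts G)" if "is_spanning_tree T' G" for T'
    using that simple_graphD(1)[OF assms(1)]
    by (intro card_mono) (auto simp: is_spanning_tree_def branch_vertices_def)
  then have "{card (branch_vertices T) | T. is_spanning_tree T G} \<subseteq> {..card (gverts G)}" by auto
  then have "finite {card (branch_vertices T) | T. is_spanning_tree T G}"
    by (rule finite_subset) simp
  then show ?thesis unfolding min_branch_value_def
    by (rule Min_eqI) (use assms(2) in \<open>auto simp: min_branch_optimal_def\<close>)
qed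

theorem proposition1:
  fixes G :: "'v ugraph"
  assumes "simple_graph G" and "connected_graph G"
  shows "(\<forall>H\<in>graph_components (full_decomposition G). \<exists>x y. ip_optimal G H x y) \<and>
    (\<forall>x y. (\<forall>H\<in>graph_components (full_decomposition G). ip_optimal G H (x H) (y H)) \<longrightarrow>
       min_branch_optimal G (assembled_graph G x)) \<and>
    int (min_branch_value G) =
      int (card (obligatory_branches G)) +
      (\<Sum>H\<in>graph_components (full_decomposition G). ip_value G H)"
proof -
  let ?C = "graph_components (full_decomposition G)"
  let ?z = "int (card (obligatory_branches G)) + (\<Sum>H\<in>?C. ip_value G H)"
  have sH: "simple_graph H" if "H \<in> ?C" for H
    using component_simple_graph[OF that] simple_graph_full_decomposition[OF assms(1)] .
  obtain T0 where T0: "is_spanning_tree T0 G" using exists_spanning_tree[OF assms] .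
  have ex: "\<exists>x y. ip_optimal G H x y" if "H \<in> ?C" for H
    using ip_feasible_of_spanning_tree[OF assms T0 that] exists_ip_optimal[OF sH[OF that]] by metis
  \<comment> \<open>\<open>T\<close> yields a feasible point of every program, whose objective is at
    least the optimum.\<close>
  have lower: "?z \<le> int (card (branch_vertices T))" if T: "is_spanning_tree T G" for T
  proof -
    have "ip_value G H \<le> int (card {v\<in>original_verts H. deg T v > 2})" if H: "H \<in> ?C" for H
    proof -
      obtain x y where xy: "ip_feasible G H x y"
        "ip_objective H y = int (card {v\<in>original_verts H. deg T v > 2})"
        using ip_feasible_of_spanning_tree[OF assms T H] .
      obtain x' y' where "ip_optimal G H x' y'" using ex[OF H] by blast
      then show ?thesis using xy ip_optimal_imp_ip_value[OF sH[OF H]]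
        unfolding ip_optimal_def by metis
    qed
    then show ?thesis unfolding card_branch_vertices[OF assms T] by (simp add: sum_mono)
  qed
  have upper: "is_spanning_tree (assembled_graph G x) G \<and>
      int (card (branch_vertices (assembled_graph G x))) \<le> ?z"
    if opt: "\<forall>H\<in>?C. ip_optimal G H (x H) (y H)" for x y
  proof -
    have feas: "ip_feasible G H (x H) (y H)" if "H \<in> ?C" for H
      using opt that by (simp add: ip_optimal_def)
    note T = assembled_graph_spanning_tree[where x = x and y = y, OF assms feas]
    have "int (card {v\<in>original_verts H. deg (assembled_graph G x) v > 2}) \<le> ip_value G H"
      if "H \<in> ?C" for H
      using T(2)[OF _ that] ip_optimal_imp_ip_value[OF sH[OF that]] opt that by metis
    then show ?thesis using T(1) by (simp add: card_branch_vertices[OF assms] sum_mono)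
  qed
  \<comment> \<open>The two bounds meet: the assembled tree attains a value below which no spanning
    tree can fall.\<close>
  have optimal: "min_branch_optimal G (assembled_graph G x) \<and>
      int (card (branch_vertices (assembled_graph G x))) = ?z"
    if "\<forall>H\<in>?C. ip_optimal G H (x H) (y H)" for x y
    using upper[OF that] lower unfolding min_branch_optimal_def
    by (meson of_nat_le_iff order.antisym order.trans)
  \<comment> \<open>Optima for all components are chosen at once, so that some assembled tree
    actually attains \<open>?z\<close>.\<close>
  obtain x y where "\<forall>H\<in>?C. ip_optimal G H (x H) (y H)" using ex by metis
  then have "int (min_branch_value G) = ?z"
    using optimal min_branch_optimal_imp_value[OF assms(1)] by metis
  then show ?thesis using ex optimal by blast
qed

end
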